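(* Let $Q$ be a rack. Then (1) $Q$ is solvable if and only if the group $\mathrm{Dis}(Q)$ is solvable; (2) $Q$ is nilpotent if and only if the group $\mathrm{Dis}(Q)$ is nilpotent.
   Context: A left quasigroup is a nonempty set $Q$ with two binary operations $*,\backslash$ satisfying $x\backslash(x*y)=y=x*(x\backslash y)$; write $L_a(b)=a*b$, a permutation of $Q$. A rack is a left quasigroup satisfying $x*(y*z)=(x*y)*(x*z)$. $\mathrm{Dis}(Q)=\langle L_aL_b^{-1}: a,b\in Q\rangle\le\mathrm{Sym}(Q)$. Congruences and terms are taken with respect to both operations $*$ and $\backslash$. For congruences $\alpha,\beta,\delta$ of an algebraic structure $A$, $C(\alpha,\beta;\delta)$ means: for every $n\ge0$, every $(n+1)$-ary term operation $t$, every $a\,\alpha\,b$ and all $u_i\,\beta\,v_i$ ($i=1,\dots,n$), $t(a,u_1,\dots,u_n)\,\delta\,t(a,v_1,\dots,v_n)$ implies $t(b,u_1,\dots,u_n)\,\delta\,t(b,v_1,\dots,v_n)$. With $0_A$ the equality relation and $1_A=A\times A$, a congruence $\alpha$ is abelian if $C(\alpha,\alpha;0_A)$ and central if $C(\alpha,1_A;0_A)$. $A$ is nilpotent (resp. solvable) if there is a finite chain of congruences $0_A=\alpha_0\le\alpha_1\le\dots\le\alpha_n=1_A$ such that $\alpha_{i+1}/\alpha_i$ is a central (resp. abelian) congruence of $A/\alpha_i$ for all $i$. (Here $\beta/\alpha$ denotes the congruence of $A/\alpha$ induced by $\beta\ge\alpha$.) *)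

theory Defs
  imports "HOL-Algebra.Solvable_Groups" "HOL-Algebra.Bij"
begin

section \<open>Left quasigroups and racks\<close>

record 'a left_quasigroup = "'a partial_object" +
  star :: "'a \<Rightarrow> 'a \<Rightarrow> 'a"  (infixl "\<star>\<index>" 70)
  ldiv :: "'a \<Rightarrow> 'a \<Rightarrow> 'a"  (infixl "\<setminus>\<index>" 70)

locale left_quasigroup =
  fixes Q (structure)
  assumes nonempty: "carrier Q \<noteq> {}"
    and star_closed: "\<lbrakk>x \<in> carrier Q; y \<in> carrier Q\<rbrakk> \<Longrightarrow> x \<star> y \<in> carrier Q"
    and ldiv_closed: "\<lbrakk>x \<in> carrier Q; y \<in> carrier Q\<rbrakk> \<Longrightarrow> x \<setminus> y \<in> carrier Q"
    and ldiv_star: "\<lbrakk>x \<in> carrier Q; y \<in> carrier Q\<rbrakk> \<Longrightarrow> x \<setminus> (x \<star> y) = y"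
    and star_ldiv: "\<lbrakk>x \<in> carrier Q; y \<in> carrier Q\<rbrakk> \<Longrightarrow> x \<star> (x \<setminus> y) = y"

locale rack = left_quasigroup +
  assumes self_distrib:
    "\<lbrakk>x \<in> carrier Q; y \<in> carrier Q; z \<in> carrier Q\<rbrakk>
      \<Longrightarrow> x \<star> (y \<star> z) = (x \<star> y) \<star> (x \<star> z)"

text \<open>Left translations are restricted to the carrier, as \<open>BijGroup\<close> consists of
  extensional functions.\<close>

definition left_translation :: "('a, 'c) left_quasigroup_scheme \<Rightarrow> 'a \<Rightarrow> 'a \<Rightarrow> 'a"
  where "left_translation Q a = (\<lambda>b\<in>carrier Q. a \<star>\<^bsub>Q\<^esub> b)"

definition Dis :: "('a, 'c) left_quasigroup_scheme \<Rightarrow> ('a \<Rightarrow> 'a) monoid"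
  where "Dis Q = subgroup_generated (BijGroup (carrier Q))
    {left_translation Q a \<otimes>\<^bsub>BijGroup (carrier Q)\<^esub>
       inv\<^bsub>BijGroup (carrier Q)\<^esub> (left_translation Q b)
     | a b. a \<in> carrier Q \<and> b \<in> carrier Q}"


section \<open>Terms, congruences and quotients\<close>

datatype lq_term = Var nat | Star lq_term lq_term | Ldiv lq_term lq_term

primrec vars :: "lq_term \<Rightarrow> nat set" where
  "vars (Var i) = {i}"
| "vars (Star s t) = vars s \<union> vars t"
| "vars (Ldiv s t) = vars s \<union> vars t"

text \<open>The argument tuple is a list. A term with variables among \<open>0, \<dots>, k - 1\<close> denotes a
  \<open>k\<close>-ary term operation, to be evaluated only at lists of length \<open>k\<close>.\<close>

primrec term_op :: "('a, 'c) left_quasigroup_scheme \<Rightarrow> lq_term \<Rightarrow> 'a list \<Rightarrow> 'a" where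
  "term_op Q (Var i) xs = xs ! i"
| "term_op Q (Star s t) xs = term_op Q s xs \<star>\<^bsub>Q\<^esub> term_op Q t xs"
| "term_op Q (Ldiv s t) xs = term_op Q s xs \<setminus>\<^bsub>Q\<^esub> term_op Q t xs"

definition congruence :: "('a, 'c) left_quasigroup_scheme \<Rightarrow> 'a rel \<Rightarrow> bool"
  where "congruence Q \<alpha> \<longleftrightarrow> equiv (carrier Q) \<alpha> \<and>
    (\<forall>x x' y y'. (x, x') \<in> \<alpha> \<longrightarrow> (y, y') \<in> \<alpha> \<longrightarrow>
      (x \<star>\<^bsub>Q\<^esub> y, x' \<star>\<^bsub>Q\<^esub> y') \<in> \<alpha> \<and> (x \<setminus>\<^bsub>Q\<^esub> y, x' \<setminus>\<^bsub>Q\<^esub> y') \<in> \<alpha>)"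

abbreviation zero_cong :: "('a, 'c) left_quasigroup_scheme \<Rightarrow> 'a rel"
  where "zero_cong Q \<equiv> Id_on (carrier Q)"

abbreviation one_cong :: "('a, 'c) left_quasigroup_scheme \<Rightarrow> 'a rel"
  where "one_cong Q \<equiv> carrier Q \<times> carrier Q"

text \<open>For a congruence \<open>\<alpha>\<close> the unions below range over representatives of the classes
  \<open>X\<close> and \<open>Y\<close>, and all contribute the same class.\<close>

definition quotient_lq ::
    "('a, 'c) left_quasigroup_scheme \<Rightarrow> 'a rel \<Rightarrow> 'a set left_quasigroup"
  where "quotient_lq Q \<alpha> =
    \<lparr>carrier = carrier Q // \<alpha>,
     star = \<lambda>X Y. \<Union>x\<in>X. \<Union>y\<in>Y. \<alpha> `` {x \<star>\<^bsub>Q\<^esub> y},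
     ldiv = \<lambda>X Y. \<Union>x\<in>X. \<Union>y\<in>Y. \<alpha> `` {x \<setminus>\<^bsub>Q\<^esub> y}\<rparr>"

definition quotient_cong :: "'a rel \<Rightarrow> 'a rel \<Rightarrow> 'a set rel"
  where "quotient_cong \<beta> \<alpha> = {(\<alpha> `` {x}, \<alpha> `` {y}) | x y. (x, y) \<in> \<beta>}"


section \<open>Centralization, solvability and nilpotence\<close>

definition centralizes ::
    "('a, 'c) left_quasigroup_scheme \<Rightarrow> 'a rel \<Rightarrow> 'a rel \<Rightarrow> 'a rel \<Rightarrow> bool"
  where "centralizes Q \<alpha> \<beta> \<delta> \<longleftrightarrow>
    (\<forall>n t a b us vs.
      vars t \<subseteq> {..n} \<longrightarrow> (a, b) \<in> \<alpha> \<longrightarrow>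
      length us = n \<longrightarrow> length vs = n \<longrightarrow> (\<forall>i<n. (us ! i, vs ! i) \<in> \<beta>) \<longrightarrow>
      (term_op Q t (a # us), term_op Q t (a # vs)) \<in> \<delta> \<longrightarrow>
      (term_op Q t (b # us), term_op Q t (b # vs)) \<in> \<delta>)"

definition abelian_cong :: "('a, 'c) left_quasigroup_scheme \<Rightarrow> 'a rel \<Rightarrow> bool"
  where "abelian_cong Q \<alpha> \<longleftrightarrow> congruence Q \<alpha> \<and> centralizes Q \<alpha> \<alpha> (zero_cong Q)"

definition central_cong :: "('a, 'c) left_quasigroup_scheme \<Rightarrow> 'a rel \<Rightarrow> bool"
  where "central_cong Q \<alpha> \<longleftrightarrow> congruence Q \<alpha> \<and> centralizes Q \<alpha> (one_cong Q) (zero_cong Q)"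

definition congruence_chain ::
    "('a, 'c) left_quasigroup_scheme \<Rightarrow> nat \<Rightarrow> (nat \<Rightarrow> 'a rel) \<Rightarrow> bool"
  where "congruence_chain Q n \<alpha> \<longleftrightarrow>
    \<alpha> 0 = zero_cong Q \<and> \<alpha> n = one_cong Q \<and>
    (\<forall>i\<le>n. congruence Q (\<alpha> i)) \<and> (\<forall>i<n. \<alpha> i \<subseteq> \<alpha> (Suc i))"

definition lq_solvable :: "('a, 'c) left_quasigroup_scheme \<Rightarrow> bool"
  where "lq_solvable Q \<longleftrightarrow> (\<exists>n \<alpha>. congruence_chain Q n \<alpha> \<and>
    (\<forall>i<n. abelian_cong (quotient_lq Q (\<alpha> i)) (quotient_cong (\<alpha> (Suc i)) (\<alpha> i))))"

definition lq_nilpotent :: "('a, 'c) left_quasigroup_scheme \<Rightarrow> bool"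
  where "lq_nilpotent Q \<longleftrightarrow> (\<exists>n \<alpha>. congruence_chain Q n \<alpha> \<and>
    (\<forall>i<n. central_cong (quotient_lq Q (\<alpha> i)) (quotient_cong (\<alpha> (Suc i)) (\<alpha> i))))"


section \<open>Nilpotent groups\<close>

definition center :: "('a, 'c) monoid_scheme \<Rightarrow> 'a set"
  where "center G = {z \<in> carrier G. \<forall>x\<in>carrier G. z \<otimes>\<^bsub>G\<^esub> x = x \<otimes>\<^bsub>G\<^esub> z}"

text \<open>Existence of a central series; the image of \<open>H (Suc i)\<close> under the projection
  \<open>x \<mapsto> H i #> x\<close> is the subgroup \<open>H (Suc i) / H i\<close> of \<open>G Mod H i\<close>.\<close>

definition nilpotent_group :: "('a, 'c) monoid_scheme \<Rightarrow> bool"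
  where "nilpotent_group G \<longleftrightarrow> (\<exists>n (H :: nat \<Rightarrow> 'a set).
    H 0 = {\<one>\<^bsub>G\<^esub>} \<and> H n = carrier G \<and> (\<forall>i\<le>n. H i \<lhd> G) \<and>
    (\<forall>i<n. H i \<subseteq> H (Suc i) \<and>
      (\<lambda>x. H i #>\<^bsub>G\<^esub> x) ` H (Suc i) \<subseteq> center (G Mod H i)))"


section \<open>Well-definedness\<close>

context left_quasigroup
begin

lemma left_translation_Bij:
  assumes "a \<in> carrier Q"
  shows "left_translation Q a \<in> carrier (BijGroup (carrier Q))"
proof -
  have "bij_betw (\<lambda>b\<in>carrier Q. a \<star> b) (carrier Q) (carrier Q)"
    by (rule bij_betw_byWitness[where f' = "\<lambda>b. a \<setminus> b"])
      (use assms in \<open>auto simp: star_closed ldiv_closed ldiv_star star_ldiv\<close>)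
  then show ?thesis
    by (simp add: BijGroup_def Bij_def left_translation_def)
qed

lemma group_Dis: "group (Dis Q)"
  unfolding Dis_def by (intro group.group_subgroup_generated group_BijGroup)

lemma carrier_Dis:
  "carrier (Dis Q) = generate (BijGroup (carrier Q))
    {left_translation Q a \<otimes>\<^bsub>BijGroup (carrier Q)\<^esub>
       inv\<^bsub>BijGroup (carrier Q)\<^esub> (left_translation Q b)
     | a b. a \<in> carrier Q \<and> b \<in> carrier Q}" (is "_ = generate ?B ?S")
proof -
  interpret B: group "BijGroup (carrier Q)" by (rule group_BijGroup)
  have "?S \<subseteq> carrier ?B"
    using left_translation_Bij by auto
  then have "carrier ?B \<inter> ?S = ?S" by blast
  then show ?thesis
    unfolding Dis_def subgroup_generated_def by simp
qed

lemma quotient_class_op: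
  assumes \<alpha>: "equiv (carrier Q) \<alpha>"
    and f: "\<And>x x' y y'. (x, x') \<in> \<alpha> \<Longrightarrow> (y, y') \<in> \<alpha> \<Longrightarrow> (f x y, f x' y') \<in> \<alpha>"
    and xy: "x \<in> carrier Q" "y \<in> carrier Q"
  shows "(\<Union>u\<in>\<alpha> `` {x}. \<Union>v\<in>\<alpha> `` {y}. \<alpha> `` {f u v}) = \<alpha> `` {f x y}"
proof -
  have "\<alpha> `` {f u v} = \<alpha> `` {f x y}" if "u \<in> \<alpha> `` {x}" "v \<in> \<alpha> `` {y}" for u v
    using equiv_class_eq[OF \<alpha> f, of x u y v] that by auto
  moreover have "x \<in> \<alpha> `` {x}" "y \<in> \<alpha> `` {y}"
    using equiv_class_self[OF \<alpha>] xy by auto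
  ultimately show ?thesis by blast
qed

lemma quotient_star:
  assumes "congruence Q \<alpha>" "x \<in> carrier Q" "y \<in> carrier Q"
  shows "\<alpha> `` {x} \<star>\<^bsub>quotient_lq Q \<alpha>\<^esub> \<alpha> `` {y} = \<alpha> `` {x \<star> y}"
  using assms quotient_class_op[of \<alpha> "(\<star>)" x y]
  by (simp add: quotient_lq_def congruence_def)

lemma quotient_ldiv:
  assumes "congruence Q \<alpha>" "x \<in> carrier Q" "y \<in> carrier Q"
  shows "\<alpha> `` {x} \<setminus>\<^bsub>quotient_lq Q \<alpha>\<^esub> \<alpha> `` {y} = \<alpha> `` {x \<setminus> y}"
  using assms quotient_class_op[of \<alpha> "(\<setminus>)" x y]
  by (simp add: quotient_lq_def congruence_def)

end

end

theory Submission
  imports Defs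
begin

text \<open>Congruences of a rack \<open>Q\<close> and normal subgroups of \<open>Dis Q\<close> are compared in both directions,
  and the term condition turns into a commutator condition each time. The quotients in the
  definitions of solvability and nilpotence disappear first: \<open>\<alpha> / \<delta>\<close> is abelian in \<open>Q / \<delta>\<close>
  exactly if \<open>C(\<alpha>, \<alpha>; \<delta>)\<close> holds in \<open>Q\<close>, and central exactly if \<open>C(\<alpha>, 1; \<delta>)\<close> does
  (\<open>centralizes_quotient_iff\<close>).

  From \<open>Q\<close> to \<open>Dis Q\<close>. A congruence \<open>\<delta>\<close> has a kernel \<open>K \<delta>\<close>, the normal subgroup of those
  \<open>g\<close> in \<open>Dis Q\<close> that fix every class of \<open>\<delta>\<close>. A single term shows that
  \<open>C(\<alpha>, \<beta>; \<delta>)\<close> puts the commutators of \<open>L\<^sub>a L\<^sub>b\<^sup>-\<^sup>1\<close> and \<open>L\<^sub>c L\<^sub>d\<^sup>-\<^sup>1\<close>, for \<open>a \<alpha> b\<close> and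
  \<open>c \<beta> d\<close>, into \<open>K \<delta>\<close> (\<open>centralizes_commutator_in_kernel\<close>). On the other hand
  \<open>[K \<alpha>, Dis Q]\<close> lies in the normal subgroup generated by the \<open>L\<^sub>a L\<^sub>b\<^sup>-\<^sup>1\<close> with \<open>a \<alpha> b\<close>
  (\<open>commutator_kernel_of_cong\<close>). So one step in a chain of congruences costs two steps in the
  group: an abelian step gives \<open>K(\<alpha>)'' \<le> K(\<delta>)\<close>, a central one advances two terms in the
  upper central series.

  From \<open>Dis Q\<close> to \<open>Q\<close>. A subgroup \<open>M\<close> of \<open>Dis Q\<close> that is invariant under conjugation by left
  translations has an orbit congruence, the relation \<open>x \<sim> g x\<close> for \<open>g \<in> M\<close>. The terms of the
  derived series and of the upper central series are invariant, because conjugation by \<open>L\<^sub>a\<close> is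
  an automorphism of \<open>Dis Q\<close>. If \<open>[L\<^sub>p L\<^sub>q\<^sup>-\<^sup>1, M] \<le> N\<close> for all \<open>p \<beta> q\<close>, then \<open>C(\<alpha>, \<beta>; \<delta>)\<close>
  holds for the orbit congruences \<open>\<alpha>\<close> of \<open>M\<close> and \<open>\<delta>\<close> of \<open>N\<close> (\<open>centralizes_orbit_rel\<close>): replacing
  \<open>a\<close> by \<open>m a\<close> in \<open>t(a, u)\<close> changes the value, up to \<open>\<delta>\<close>, by an element of \<open>M\<close> that stays
  the same when \<open>u\<close> varies in its \<open>\<beta>\<close>-class. For two successive terms of the derived series,
  with \<open>\<beta> = \<alpha>\<close>, or of the upper central series, with \<open>\<beta> = 1\<close>, the hypothesis holds. The chain of
  congruences ends at the orbits of \<open>Dis Q\<close>, and one more step reaches the full relation: modulo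
  these orbits \<open>x \<star> y\<close> does not depend on \<open>x\<close>, so every term depends on one variable only
  (\<open>centralizes_one_cong_orbit_rel_Dis\<close>).\<close>

section \<open>Commutators and central series\<close>

definition commutator :: "('g, 'm) monoid_scheme \<Rightarrow> 'g \<Rightarrow> 'g \<Rightarrow> 'g"
  where "commutator G g h = g \<otimes>\<^bsub>G\<^esub> h \<otimes>\<^bsub>G\<^esub> inv\<^bsub>G\<^esub> g \<otimes>\<^bsub>G\<^esub> inv\<^bsub>G\<^esub> h"

primrec upper_central :: "('g, 'm) monoid_scheme \<Rightarrow> nat \<Rightarrow> 'g set" where
  "upper_central G 0 = {\<one>\<^bsub>G\<^esub>}"
| "upper_central G (Suc n) =
    {g \<in> carrier G. \<forall>h\<in>carrier G. commutator G g h \<in> upper_central G n}"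

context group
begin

lemma cancel_inv_mult [simp]:
  assumes "x \<in> carrier G" "y \<in> carrier G"
  shows "x \<otimes> (inv x \<otimes> y) = y" "inv x \<otimes> (x \<otimes> y) = y"
  using assms by (simp_all add: m_assoc[symmetric])

lemma commutator_closed [simp]:
  "g \<in> carrier G \<Longrightarrow> h \<in> carrier G \<Longrightarrow> commutator G g h \<in> carrier G"
  by (simp add: commutator_def)

lemma inv_commutator:
  "g \<in> carrier G \<Longrightarrow> h \<in> carrier G \<Longrightarrow> inv (commutator G g h) = commutator G h g"
  by (simp add: commutator_def inv_mult_group m_assoc)

lemma commutator_mult_right:
  assumes "g \<in> carrier G" "h \<in> carrier G" "k \<in> carrier G"
  shows "commutator G g (h \<otimes> k) = commutator G g h \<otimes> (h \<otimes> commutator G g k \<otimes> inv h)"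
  using assms by (simp add: commutator_def inv_mult_group m_assoc)

lemma commutator_mult_left:
  assumes "g \<in> carrier G" "h \<in> carrier G" "k \<in> carrier G"
  shows "commutator G (g \<otimes> h) k = (g \<otimes> commutator G h k \<otimes> inv g) \<otimes> commutator G g k"
  using assms by (simp add: commutator_def inv_mult_group m_assoc)

lemma commutator_inv_right:
  assumes "g \<in> carrier G" "h \<in> carrier G"
  shows "commutator G g (inv h) = inv h \<otimes> inv (commutator G g h) \<otimes> h"
  using assms by (simp add: commutator_def inv_mult_group m_assoc)

lemma commutator_inv_left:
  assumes "g \<in> carrier G" "h \<in> carrier G"
  shows "commutator G (inv g) h = inv g \<otimes> inv (commutator G g h) \<otimes> g"
  using assms by (simp add: commutator_def inv_mult_group m_assoc)

lemma commutator_conj_left: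
  assumes "x \<in> carrier G" "g \<in> carrier G" "h \<in> carrier G"
  shows "commutator G (x \<otimes> g \<otimes> inv x) h = x \<otimes> commutator G g (inv x \<otimes> h \<otimes> x) \<otimes> inv x"
  using assms by (simp add: commutator_def inv_mult_group m_assoc)

lemma normal_conj:
  assumes "K \<lhd> G" "k \<in> K" "g \<in> carrier G"
  shows "g \<otimes> k \<otimes> inv g \<in> K" "inv g \<otimes> k \<otimes> g \<in> K"
  using assms by (auto simp: normal.inv_op_closed1 normal.inv_op_closed2)

lemma commutator_swap_in_normal:
  assumes "K \<lhd> G" "g \<in> carrier G" "h \<in> carrier G" "commutator G g h \<in> K"
  shows "commutator G h g \<in> K"
  using assms by (metis inv_commutator normal_imp_subgroup subgroup.m_inv_closed)

text \<open>Modulo a normal subgroup, the elements commuting with \<open>g\<close> form a subgroup.\<close>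

lemma commutator_generate_in_normal:
  assumes K: "K \<lhd> G" and g: "g \<in> carrier G" and S: "S \<subseteq> carrier G"
    and comm: "\<And>s. s \<in> S \<Longrightarrow> commutator G g s \<in> K"
    and h: "h \<in> generate G S"
  shows "commutator G g h \<in> K"
proof -
  interpret K: subgroup K G using K by (rule normal_imp_subgroup)
  from h show ?thesis
  proof induction
    case one
    show ?case using g by (simp add: commutator_def)
  next
    case (incl h)
    then show ?case by (rule comm)
  next
    case (inv h)
    then show ?case
      using S g comm[of h] normal_conj(2)[OF K, of "inv (commutator G g h)" h]
      by (auto simp: commutator_inv_right)
  next
    case (eng h1 h2)
    then have "h1 \<in> carrier G" "h2 \<in> carrier G"
      using generate_in_carrier[OF S] by auto
    then show ?case
      using g eng normal_conj(1)[OF K] by (simp add: commutator_mult_right)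
  qed
qed

text \<open>Both entries of a commutator may be extended from generators to the generated subgroup,
  one after the other.\<close>

lemma derived_generate_subset_normal:
  assumes K: "K \<lhd> G" and S: "S \<subseteq> carrier G"
    and comm: "\<And>s t. s \<in> S \<Longrightarrow> t \<in> S \<Longrightarrow> commutator G s t \<in> K"
  shows "derived G (generate G S) \<subseteq> K"
proof -
  interpret K: subgroup K G using K by (rule normal_imp_subgroup)
  have in_carrier: "h \<in> carrier G" if "h \<in> generate G S" for h
    using generate_in_carrier[OF S that] .
  have 1: "commutator G h s \<in> K" if "s \<in> S" "h \<in> generate G S" for s h
  proof -
    have s: "s \<in> carrier G" using that S by auto
    have "commutator G s h \<in> K"
      using K s S comm[OF that(1)] that(2) by (rule commutator_generate_in_normal)
    then show ?thesis
      using commutator_swap_in_normal[OF K s in_carrier[OF that(2)]] by blast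
  qed
  have "commutator G g h \<in> K" if "g \<in> generate G S" "h \<in> generate G S" for g h
    using K in_carrier[OF that(1)] S 1[OF _ that(1)] that(2) by (rule commutator_generate_in_normal)
  then have "derived_set G (generate G S) \<subseteq> K"
    by (auto simp: commutator_def)
  then show ?thesis
    unfolding derived_def using K.subgroup_axioms by (rule generate_subgroup_incl)
qed

lemma normal_upper_central: "upper_central G n \<lhd> G"
proof (induction n)
  case 0
  show ?case by (simp add: one_is_normal)
next
  case (Suc n)
  interpret K: subgroup "upper_central G n" G using Suc by (rule normal_imp_subgroup)
  have "subgroup (upper_central G (Suc n)) G"
  proof (rule subgroupI)
    show "upper_central G (Suc n) \<noteq> {}"
      by (auto simp: commutator_def intro: exI[of _ \<one>])
    show "inv g \<in> upper_central G (Suc n)" if "g \<in> upper_central G (Suc n)" for g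
      using that normal_conj(2)[OF Suc, of "inv (commutator G g h)" g for h]
      by (simp add: commutator_inv_left)
    show "g \<otimes> h \<in> upper_central G (Suc n)"
      if "g \<in> upper_central G (Suc n)" "h \<in> upper_central G (Suc n)" for g h
      using that normal_conj(1)[OF Suc] by (simp add: commutator_mult_left)
  qed auto
  moreover have "x \<otimes> g \<otimes> inv x \<in> upper_central G (Suc n)"
    if "x \<in> carrier G" "g \<in> upper_central G (Suc n)" for x g
    using that normal_conj(1)[OF Suc] by (simp add: commutator_conj_left)
  ultimately show ?case
    by (simp add: normal_inv_iff)
qed

lemma upper_central_mono: "upper_central G n \<subseteq> upper_central G (Suc n)"
proof
  fix g assume g: "g \<in> upper_central G n"
  interpret K: subgroup "upper_central G n" G
    using normal_upper_central by (rule normal_imp_subgroup)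
  have "commutator G g h \<in> upper_central G n" if h: "h \<in> carrier G" for h
  proof -
    have "commutator G g h = g \<otimes> (h \<otimes> inv g \<otimes> inv h)"
      using g h by (simp add: commutator_def m_assoc)
    then show ?thesis
      using g h normal_conj(1)[OF normal_upper_central, of "inv g" n h] by simp
  qed
  then show "g \<in> upper_central G (Suc n)" using g by simp
qed

lemma coset_in_center_iff:
  assumes K: "K \<lhd> G" and g: "g \<in> carrier G"
  shows "K #> g \<in> center (G Mod K) \<longleftrightarrow> (\<forall>h\<in>carrier G. commutator G g h \<in> K)"
proof -
  interpret K: normal K G by (rule K)
  have comm: "K #> (g \<otimes> h) = K #> (h \<otimes> g) \<longleftrightarrow> commutator G g h \<in> K"
    if h: "h \<in> carrier G" for h
  proof -
    have gh: "g \<otimes> h \<in> carrier G" "h \<otimes> g \<in> carrier G" using g h by simp_all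
    have "K #> (g \<otimes> h) = K #> (h \<otimes> g) \<longleftrightarrow> g \<otimes> h \<in> K #> (h \<otimes> g)"
      using rcos_self[OF gh(1) K.subgroup_axioms]
        repr_independence[OF _ gh(2) K.subgroup_axioms, of "g \<otimes> h"] by blast
    also have "\<dots> \<longleftrightarrow> (g \<otimes> h) \<otimes> inv (h \<otimes> g) \<in> K"
      using K.rcos_module[OF is_group gh(2) gh(1)] .
    finally have "K #> (g \<otimes> h) = K #> (h \<otimes> g) \<longleftrightarrow> (g \<otimes> h) \<otimes> inv (h \<otimes> g) \<in> K" .
    then show ?thesis
      using g h by (simp add: commutator_def inv_mult_group m_assoc)
  qed
  have "K #> g \<in> center (G Mod K) \<longleftrightarrow>
      (\<forall>h\<in>carrier G. (K #> g) <#> (K #> h) = (K #> h) <#> (K #> g))"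
    using g by (auto simp: center_def FactGroup_def RCOSETS_def)
  also have "\<dots> \<longleftrightarrow> (\<forall>h\<in>carrier G. K #> (g \<otimes> h) = K #> (h \<otimes> g))"
    using g by (simp add: K.rcos_sum)
  finally show ?thesis using comm by simp
qed

text \<open>The upper central series grows at least as fast as any central series.\<close>

lemma nilpotent_group_iff_upper_central:
  "nilpotent_group G \<longleftrightarrow> (\<exists>n. upper_central G n = carrier G)"
proof
  assume "nilpotent_group G"
  then obtain n H where H: "H 0 = {\<one>} \<and> H n = carrier G \<and> (\<forall>i\<le>n. H i \<lhd> G) \<and>
      (\<forall>i<n. H i \<subseteq> H (Suc i) \<and> (\<lambda>x. H i #> x) ` H (Suc i) \<subseteq> center (G Mod H i))"
    unfolding nilpotent_group_def by (elim exE)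
  then have H0: "H 0 = {\<one>}" and Hn: "H n = carrier G"
    and normal: "\<And>i. i \<le> n \<Longrightarrow> H i \<lhd> G"
    and central: "\<And>i. i < n \<Longrightarrow> (\<lambda>x. H i #> x) ` H (Suc i) \<subseteq> center (G Mod H i)"
    by simp_all
  have "H i \<subseteq> upper_central G i" if "i \<le> n" for i
    using that
  proof (induction i)
    case 0
    show ?case by (simp add: H0)
  next
    case (Suc i)
    have "commutator G g h \<in> H i" if "g \<in> H (Suc i)" "h \<in> carrier G" for g h
    proof -
      have "g \<in> carrier G"
        using that normal[OF Suc.prems] by (meson normal_imp_subgroup subgroup.mem_carrier)
      then show ?thesis
        using that central[of i] coset_in_center_iff[OF normal[of i], of g] Suc.prems by auto
    qed
    moreover have "H (Suc i) \<subseteq> carrier G"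
      using normal[OF Suc.prems] by (meson normal_imp_subgroup subgroup.subset)
    ultimately show ?case using Suc by auto
  qed
  then have "upper_central G n = carrier G"
    using Hn subgroup.subset[OF normal_imp_subgroup[OF normal_upper_central]] by blast
  then show "\<exists>n. upper_central G n = carrier G" ..
next
  assume "\<exists>n. upper_central G n = carrier G"
  then obtain n where n: "upper_central G n = carrier G" ..
  have "(\<lambda>x. upper_central G i #> x) ` upper_central G (Suc i) \<subseteq> center (G Mod upper_central G i)"
    for i
    using coset_in_center_iff[OF normal_upper_central] by auto
  then show "nilpotent_group G"
    unfolding nilpotent_group_def
    using n normal_upper_central upper_central_mono
    by (intro exI[of _ n] exI[of _ "upper_central G"]) (simp del: upper_central.simps(2))
qed

text \<open>Together with \<open>derived_series_iso_image\<close>, this makes the two series usable although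
  conjugation by a left translation need not be an inner automorphism of the displacement group.\<close>

lemma upper_central_iso_image:
  assumes "\<psi> \<in> iso G G"
  shows "\<psi> ` upper_central G n = upper_central G n"
proof -
  have sub: "\<phi> ` upper_central G n \<subseteq> upper_central G n" if \<phi>: "\<phi> \<in> iso G G" for \<phi>
  proof (induction n)
    case 0
    interpret group_hom G G \<phi>
      using \<phi> by (simp add: group_hom_def group_hom_axioms_def iso_def)
    show ?case by simp
  next
    case (Suc n)
    interpret group_hom G G \<phi>
      using \<phi> by (simp add: group_hom_def group_hom_axioms_def iso_def)
    show ?case
    proof (rule image_subsetI)
      fix g assume "g \<in> upper_central G (Suc n)"
      then have g: "g \<in> carrier G" "\<forall>h\<in>carrier G. commutator G g h \<in> upper_central G n"
        by simp_all
      have "commutator G (\<phi> g) k \<in> upper_central G n" if k: "k \<in> carrier G" for k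
      proof -
        from \<phi> k obtain h where h: "h \<in> carrier G" "k = \<phi> h"
          by (auto simp: iso_def bij_betw_def)
        then have "commutator G (\<phi> g) k = \<phi> (commutator G g h)"
          using g by (simp add: commutator_def)
        then show ?thesis
          using Suc g h by auto
      qed
      then show "\<phi> g \<in> upper_central G (Suc n)"
        using g by simp
    qed
  qed
  let ?\<phi> = "inv_into (carrier G) \<psi>"
  have inv: "?\<phi> \<in> iso G G" using assms by (rule iso_set_sym)
  have "g \<in> \<psi> ` upper_central G n" if g: "g \<in> upper_central G n" for g
  proof -
    have "g \<in> carrier G"
      using g normal_upper_central by (meson normal_imp_subgroup subgroup.mem_carrier)
    then have "\<psi> (?\<phi> g) = g"
      using assms by (auto simp: iso_def bij_betw_def intro!: f_inv_into_f)
    then show ?thesis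
      using sub[OF inv] g by force
  qed
  with sub[OF assms] show ?thesis by blast
qed

lemma derived_series_iso_image:
  assumes "\<psi> \<in> iso G G"
  shows "\<psi> ` (derived G ^^ n) (carrier G) = (derived G ^^ n) (carrier G)"
proof -
  interpret group_hom G G \<psi>
    using assms by (simp add: group_hom_def group_hom_axioms_def iso_def)
  show ?thesis
    using exp_of_derived_img[of "carrier G" n] assms by (simp add: iso_def bij_betw_def)
qed

end

section \<open>Congruences, quotients and the term condition\<close>

lemma congruence_equiv: "congruence Q \<delta> \<Longrightarrow> equiv (carrier Q) \<delta>"
  by (simp add: congruence_def)

lemma congruence_in_carrier:
  assumes "congruence Q \<delta>" "(x, y) \<in> \<delta>"
  shows "x \<in> carrier Q" "y \<in> carrier Q"
  using equiv_type[OF congruence_equiv[OF assms(1)]] assms(2) by auto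

lemma congruence_refl: "congruence Q \<delta> \<Longrightarrow> x \<in> carrier Q \<Longrightarrow> (x, x) \<in> \<delta>"
  by (meson congruence_equiv equivE refl_onD)

lemma congruence_sym: "congruence Q \<delta> \<Longrightarrow> (x, y) \<in> \<delta> \<Longrightarrow> (y, x) \<in> \<delta>"
  by (meson congruence_equiv equivE symE)

lemma congruence_trans:
  "congruence Q \<delta> \<Longrightarrow> (x, y) \<in> \<delta> \<Longrightarrow> (y, z) \<in> \<delta> \<Longrightarrow> (x, z) \<in> \<delta>"
  by (meson congruence_equiv equivE transE)

lemma congruence_star:
  "congruence Q \<delta> \<Longrightarrow> (x, x') \<in> \<delta> \<Longrightarrow> (y, y') \<in> \<delta> \<Longrightarrow> (x \<star>\<^bsub>Q\<^esub> y, x' \<star>\<^bsub>Q\<^esub> y') \<in> \<delta>"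
  by (simp add: congruence_def)

lemma congruence_ldiv:
  "congruence Q \<delta> \<Longrightarrow> (x, x') \<in> \<delta> \<Longrightarrow> (y, y') \<in> \<delta> \<Longrightarrow> (x \<setminus>\<^bsub>Q\<^esub> y, x' \<setminus>\<^bsub>Q\<^esub> y') \<in> \<delta>"
  by (simp add: congruence_def)

lemma congruence_class_eq_iff:
  assumes "congruence Q \<delta>" "x \<in> carrier Q" "y \<in> carrier Q"
  shows "\<delta> `` {x} = \<delta> `` {y} \<longleftrightarrow> (x, y) \<in> \<delta>"
  using eq_equiv_class_iff[OF congruence_equiv[OF assms(1)]] assms(2,3) by blast

lemma term_op_congruent:
  assumes "congruence Q \<delta>" "list_all2 (\<lambda>x y. (x, y) \<in> \<delta>) xs ys" "vars t \<subseteq> {..<length xs}"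
  shows "(term_op Q t xs, term_op Q t ys) \<in> \<delta>"
  using assms(3)
  by (induction t)
    (use assms(1,2) in \<open>auto intro: list_all2_nthD congruence_star congruence_ldiv\<close>)

context left_quasigroup
begin

lemma congruence_one_cong: "congruence Q (one_cong Q)"
  by (auto simp: congruence_def equiv_def refl_on_def sym_def trans_def star_closed ldiv_closed)

lemma term_op_closed:
  "vars t \<subseteq> {..<length xs} \<Longrightarrow> set xs \<subseteq> carrier Q \<Longrightarrow> term_op Q t xs \<in> carrier Q"
  by (induction t) (auto intro: star_closed ldiv_closed)

lemma term_op_quotient:
  assumes "congruence Q \<delta>" "set xs \<subseteq> carrier Q" "vars t \<subseteq> {..<length xs}"
  shows "term_op (quotient_lq Q \<delta>) t (map (\<lambda>x. \<delta> `` {x}) xs) = \<delta> `` {term_op Q t xs}"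
  using assms(3)
  by (induction t)
    (use assms(1,2) in \<open>auto simp: quotient_star quotient_ldiv term_op_closed\<close>)

lemma congruence_quotient_cong:
  assumes \<alpha>: "congruence Q \<alpha>" and \<beta>: "congruence Q \<beta>" and le: "\<alpha> \<subseteq> \<beta>"
  shows "congruence (quotient_lq Q \<alpha>) (quotient_cong \<beta> \<alpha>)"
proof -
  have carrier: "carrier (quotient_lq Q \<alpha>) = carrier Q // \<alpha>"
    by (simp add: quotient_lq_def)
  have mem_iff: "(\<alpha> `` {x}, \<alpha> `` {y}) \<in> quotient_cong \<beta> \<alpha> \<longleftrightarrow> (x, y) \<in> \<beta>"
    if "x \<in> carrier Q" "y \<in> carrier Q" for x y
  proof
    assume "(\<alpha> `` {x}, \<alpha> `` {y}) \<in> quotient_cong \<beta> \<alpha>"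
    then obtain x' y' where *: "\<alpha> `` {x} = \<alpha> `` {x'}" "\<alpha> `` {y} = \<alpha> `` {y'}" "(x', y') \<in> \<beta>"
      by (auto simp: quotient_cong_def)
    then have "(x, x') \<in> \<beta>" "(y', y) \<in> \<beta>"
      using le that congruence_class_eq_iff[OF \<alpha>] congruence_in_carrier[OF \<beta> *(3)]
      by (blast, metis congruence_sym[OF \<beta>] subsetD)
    then show "(x, y) \<in> \<beta>"
      using *(3) congruence_trans[OF \<beta>] by blast
  qed (auto simp: quotient_cong_def)
  have repr: "\<exists>x y. X = \<alpha> `` {x} \<and> Y = \<alpha> `` {y} \<and> (x, y) \<in> \<beta> \<and> x \<in> carrier Q \<and> y \<in> carrier Q"
    if "(X, Y) \<in> quotient_cong \<beta> \<alpha>" for X Y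
    using that congruence_in_carrier[OF \<beta>] by (fastforce simp: quotient_cong_def)
  have "equiv (carrier Q // \<alpha>) (quotient_cong \<beta> \<alpha>)"
  proof (rule equivI)
    show "quotient_cong \<beta> \<alpha> \<subseteq> (carrier Q // \<alpha>) \<times> (carrier Q // \<alpha>)"
      by (auto dest!: repr intro: quotientI)
    show "refl_on (carrier Q // \<alpha>) (quotient_cong \<beta> \<alpha>)"
      using congruence_refl[OF \<beta>] by (auto simp: refl_on_def mem_iff elim!: quotientE)
    show "sym (quotient_cong \<beta> \<alpha>)"
      by (rule symI) (auto dest!: repr simp: mem_iff intro: congruence_sym[OF \<beta>])
    show "trans (quotient_cong \<beta> \<alpha>)"
    proof (rule transI)
      fix X Y Z assume XY: "(X, Y) \<in> quotient_cong \<beta> \<alpha>" and YZ: "(Y, Z) \<in> quotient_cong \<beta> \<alpha>"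
      from repr[OF XY] obtain x y where
        x: "X = \<alpha> `` {x}" "Y = \<alpha> `` {y}" "(x, y) \<in> \<beta>" "x \<in> carrier Q" "y \<in> carrier Q" by blast
      from repr[OF YZ] obtain z where z: "Z = \<alpha> `` {z}" "z \<in> carrier Q" by blast
      have "(y, z) \<in> \<beta>" using YZ x z by (simp add: mem_iff)
      then show "(X, Z) \<in> quotient_cong \<beta> \<alpha>"
        using x z congruence_trans[OF \<beta> x(3)] by (simp add: mem_iff)
    qed
  qed
  moreover have "(X \<star>\<^bsub>quotient_lq Q \<alpha>\<^esub> Y, X' \<star>\<^bsub>quotient_lq Q \<alpha>\<^esub> Y') \<in> quotient_cong \<beta> \<alpha> \<and>
      (X \<setminus>\<^bsub>quotient_lq Q \<alpha>\<^esub> Y, X' \<setminus>\<^bsub>quotient_lq Q \<alpha>\<^esub> Y') \<in> quotient_cong \<beta> \<alpha>"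
    if XX: "(X, X') \<in> quotient_cong \<beta> \<alpha>" and YY: "(Y, Y') \<in> quotient_cong \<beta> \<alpha>" for X X' Y Y'
  proof -
    from repr[OF XX] obtain x x' where x: "X = \<alpha> `` {x}" "X' = \<alpha> `` {x'}" "(x, x') \<in> \<beta>"
      "x \<in> carrier Q" "x' \<in> carrier Q" by blast
    from repr[OF YY] obtain y y' where y: "Y = \<alpha> `` {y}" "Y' = \<alpha> `` {y'}" "(y, y') \<in> \<beta>"
      "y \<in> carrier Q" "y' \<in> carrier Q" by blast
    show ?thesis
      using x y congruence_star[OF \<beta> x(3) y(3)] congruence_ldiv[OF \<beta> x(3) y(3)]
      by (simp add: quotient_star[OF \<alpha>] quotient_ldiv[OF \<alpha>] mem_iff star_closed ldiv_closed)
  qed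
  ultimately show ?thesis
    by (simp add: congruence_def carrier)
qed

lemma quotient_cong_one_cong: "quotient_cong (one_cong Q) \<alpha> = one_cong (quotient_lq Q \<alpha>)"
  by (auto simp: quotient_cong_def quotient_lq_def quotient_def)

text \<open>Terms commute with the projection to \<open>Q / \<delta>\<close> and every tuple of classes has
  representatives, so the term condition in a quotient is one in \<open>Q\<close> itself.\<close>

lemma centralizes_quotient_iff:
  assumes \<delta>: "congruence Q \<delta>" and \<alpha>: "congruence Q \<alpha>" and \<beta>: "congruence Q \<beta>"
  shows "centralizes (quotient_lq Q \<delta>) (quotient_cong \<alpha> \<delta>) (quotient_cong \<beta> \<delta>)
      (zero_cong (quotient_lq Q \<delta>)) \<longleftrightarrow> centralizes Q \<alpha> \<beta> \<delta>"
proof -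
  let ?c = "\<lambda>x. \<delta> `` {x}" and ?R = "quotient_lq Q \<delta>"
  have same_class: "(term_op ?R t (?c a # map ?c us), term_op ?R t (?c a # map ?c vs)) \<in> zero_cong ?R
      \<longleftrightarrow> (term_op Q t (a # us), term_op Q t (a # vs)) \<in> \<delta>"
    if "vars t \<subseteq> {..n}" "a \<in> carrier Q" "length us = n" "length vs = n"
      "\<forall>i<n. (us ! i, vs ! i) \<in> \<beta>" for n t a us vs
  proof -
    have "set us \<subseteq> carrier Q" "set vs \<subseteq> carrier Q"
      using that congruence_in_carrier[OF \<beta>] by (metis in_set_conv_nth subsetI)+
    moreover have "vars t \<subseteq> {..<length (a # us)}" "vars t \<subseteq> {..<length (a # vs)}"
      using that by (auto simp: lessThan_Suc_atMost)
    ultimately show ?thesis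
      using term_op_quotient[OF \<delta>, of "a # us" t] term_op_quotient[OF \<delta>, of "a # vs" t]
        term_op_closed[of t "a # us"] term_op_closed[of t "a # vs"] that
      by (auto simp: Id_on_iff quotient_lq_def congruence_class_eq_iff[OF \<delta>] intro: quotientI)
  qed
  show ?thesis
  proof
    assume C: "centralizes ?R (quotient_cong \<alpha> \<delta>) (quotient_cong \<beta> \<delta>) (zero_cong ?R)"
    show "centralizes Q \<alpha> \<beta> \<delta>"
      unfolding centralizes_def
    proof (intro allI impI)
      fix n t a b us vs
      assume A: "vars t \<subseteq> {..n}" "(a, b) \<in> \<alpha>" "length us = n" "length vs = n"
        "\<forall>i<n. (us ! i, vs ! i) \<in> \<beta>" "(term_op Q t (a # us), term_op Q t (a # vs)) \<in> \<delta>"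
      have "(?c a, ?c b) \<in> quotient_cong \<alpha> \<delta>"
        "\<forall>i<n. (map ?c us ! i, map ?c vs ! i) \<in> quotient_cong \<beta> \<delta>"
        using A by (auto simp: quotient_cong_def)
      then have "(term_op ?R t (?c b # map ?c us), term_op ?R t (?c b # map ?c vs)) \<in> zero_cong ?R"
        using C[unfolded centralizes_def, rule_format, of t n "?c a" "?c b" "map ?c us" "map ?c vs"]
          A same_class[OF A(1) _ A(3-5)] congruence_in_carrier[OF \<alpha> A(2)] by simp
      then show "(term_op Q t (b # us), term_op Q t (b # vs)) \<in> \<delta>"
        using A same_class[OF A(1) _ A(3-5)] congruence_in_carrier[OF \<alpha> A(2)] by simp
    qed
  next
    assume C: "centralizes Q \<alpha> \<beta> \<delta>"
    show "centralizes ?R (quotient_cong \<alpha> \<delta>) (quotient_cong \<beta> \<delta>) (zero_cong ?R)"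
      unfolding centralizes_def
    proof (intro allI impI)
      fix n t A B Us Vs
      assume A: "vars t \<subseteq> {..n}" "(A, B) \<in> quotient_cong \<alpha> \<delta>" "length Us = n" "length Vs = n"
        "\<forall>i<n. (Us ! i, Vs ! i) \<in> quotient_cong \<beta> \<delta>"
        "(term_op ?R t (A # Us), term_op ?R t (A # Vs)) \<in> zero_cong ?R"
      obtain a b where ab: "A = ?c a" "B = ?c b" "(a, b) \<in> \<alpha>"
        using A(2) by (auto simp: quotient_cong_def)
      have "\<forall>i. \<exists>x y. i < n \<longrightarrow> Us ! i = ?c x \<and> Vs ! i = ?c y \<and> (x, y) \<in> \<beta>"
        using A(5) by (auto simp: quotient_cong_def)
      then obtain f g where fg: "\<And>i. i < n \<Longrightarrow> Us ! i = ?c (f i) \<and> Vs ! i = ?c (g i) \<and> (f i, g i) \<in> \<beta>"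
        by metis
      define us vs where "us = map f [0..<n]" and "vs = map g [0..<n]"
      have len: "length us = n" "length vs = n" "\<forall>i<n. (us ! i, vs ! i) \<in> \<beta>"
        using fg by (auto simp: us_def vs_def)
      have eq: "Us = map ?c us" "Vs = map ?c vs"
        using A fg by (auto simp: us_def vs_def intro!: nth_equalityI)
      have "(term_op Q t (a # us), term_op Q t (a # vs)) \<in> \<delta>"
        using same_class[OF A(1) _ len] A(6) congruence_in_carrier[OF \<alpha> ab(3)] by (simp add: ab eq)
      then have "(term_op Q t (b # us), term_op Q t (b # vs)) \<in> \<delta>"
        using C A(1) ab(3) len unfolding centralizes_def by blast
      then show "(term_op ?R t (B # Us), term_op ?R t (B # Vs)) \<in> zero_cong ?R"
        using same_class[OF A(1) _ len] congruence_in_carrier[OF \<alpha> ab(3)] by (simp add: ab eq)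
    qed
  qed
qed

lemma lq_solvable_iff:
  "lq_solvable Q \<longleftrightarrow> (\<exists>n \<alpha>. congruence_chain Q n \<alpha> \<and>
    (\<forall>i<n. centralizes Q (\<alpha> (Suc i)) (\<alpha> (Suc i)) (\<alpha> i)))"
proof -
  have "abelian_cong (quotient_lq Q (\<alpha> i)) (quotient_cong (\<alpha> (Suc i)) (\<alpha> i)) \<longleftrightarrow>
      centralizes Q (\<alpha> (Suc i)) (\<alpha> (Suc i)) (\<alpha> i)"
    if "congruence_chain Q n \<alpha>" "i < n" for n \<alpha> i
    using that
    by (simp add: abelian_cong_def congruence_chain_def congruence_quotient_cong
        centralizes_quotient_iff)
  then show ?thesis
    unfolding lq_solvable_def by blast
qed

lemma lq_nilpotent_iff:
  "lq_nilpotent Q \<longleftrightarrow> (\<exists>n \<alpha>. congruence_chain Q n \<alpha> \<and>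
    (\<forall>i<n. centralizes Q (\<alpha> (Suc i)) (one_cong Q) (\<alpha> i)))"
proof -
  have "central_cong (quotient_lq Q (\<alpha> i)) (quotient_cong (\<alpha> (Suc i)) (\<alpha> i)) \<longleftrightarrow>
      centralizes Q (\<alpha> (Suc i)) (one_cong Q) (\<alpha> i)"
    if "congruence_chain Q n \<alpha>" "i < n" for n \<alpha> i
    using that
    by (simp add: central_cong_def congruence_chain_def congruence_quotient_cong
        centralizes_quotient_iff congruence_one_cong flip: quotient_cong_one_cong)
  then show ?thesis
    unfolding lq_nilpotent_def by blast
qed

end

section \<open>The displacement group\<close>

definition displacement :: "('a, 'c) left_quasigroup_scheme \<Rightarrow> 'a \<Rightarrow> 'a \<Rightarrow> 'a \<Rightarrow> 'a"
  where "displacement Q a b = left_translation Q a \<otimes>\<^bsub>BijGroup (carrier Q)\<^esub>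
    inv\<^bsub>BijGroup (carrier Q)\<^esub> (left_translation Q b)"

definition kernel_of_cong :: "('a, 'c) left_quasigroup_scheme \<Rightarrow> 'a rel \<Rightarrow> ('a \<Rightarrow> 'a) set"
  where "kernel_of_cong Q \<delta> = {g \<in> carrier (Dis Q). \<forall>x\<in>carrier Q. (g x, x) \<in> \<delta>}"

definition orbit_rel :: "('a, 'c) left_quasigroup_scheme \<Rightarrow> ('a \<Rightarrow> 'a) set \<Rightarrow> 'a rel"
  where "orbit_rel Q M = {(x, g x) | x g. x \<in> carrier Q \<and> g \<in> M}"

definition translation_conj ::
    "('a, 'c) left_quasigroup_scheme \<Rightarrow> 'a \<Rightarrow> ('a \<Rightarrow> 'a) \<Rightarrow> 'a \<Rightarrow> 'a"
  where "translation_conj Q a g = left_translation Q a \<otimes>\<^bsub>BijGroup (carrier Q)\<^esub> g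
    \<otimes>\<^bsub>BijGroup (carrier Q)\<^esub> inv\<^bsub>BijGroup (carrier Q)\<^esub> (left_translation Q a)"

context left_quasigroup
begin

abbreviation "B \<equiv> BijGroup (carrier Q)"
abbreviation "L \<equiv> left_translation Q"
abbreviation "D \<equiv> Dis Q"

sublocale B: group B by (rule group_BijGroup)
sublocale D: group D by (rule group_Dis)

lemma B_apply_closed: "g \<in> carrier B \<Longrightarrow> x \<in> carrier Q \<Longrightarrow> g x \<in> carrier Q"
  by (auto simp: BijGroup_def dest: Bij_imp_funcset)

lemma B_mult_apply:
  "g \<in> carrier B \<Longrightarrow> h \<in> carrier B \<Longrightarrow> x \<in> carrier Q \<Longrightarrow> (g \<otimes>\<^bsub>B\<^esub> h) x = g (h x)"
  by (simp add: BijGroup_def compose_eq)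

lemma B_one_apply: "x \<in> carrier Q \<Longrightarrow> \<one>\<^bsub>B\<^esub> x = x"
  by (simp add: BijGroup_def)

lemma B_inv_apply:
  assumes "g \<in> carrier B" "x \<in> carrier Q"
  shows "(inv\<^bsub>B\<^esub> g) (g x) = x" "g ((inv\<^bsub>B\<^esub> g) x) = x"
  using assms B_mult_apply[of "inv\<^bsub>B\<^esub> g" g x] B_mult_apply[of g "inv\<^bsub>B\<^esub> g" x]
  by (simp_all add: B_one_apply)

lemma B_eqI:
  assumes "g \<in> carrier B" "h \<in> carrier B" "\<And>x. x \<in> carrier Q \<Longrightarrow> g x = h x"
  shows "g = h"
  using assms by (auto simp: BijGroup_def Bij_def intro: extensionalityI)

lemma L_closed: "a \<in> carrier Q \<Longrightarrow> L a \<in> carrier B"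
  by (rule left_translation_Bij)

lemma L_apply: "a \<in> carrier Q \<Longrightarrow> x \<in> carrier Q \<Longrightarrow> L a x = a \<star> x"
  by (simp add: left_translation_def)

lemma inv_L_apply:
  assumes "a \<in> carrier Q" "x \<in> carrier Q"
  shows "(inv\<^bsub>B\<^esub> (L a)) x = a \<setminus> x"
  using B_inv_apply(1)[OF L_closed[OF assms(1)] ldiv_closed[OF assms]] assms
  by (simp add: L_apply ldiv_closed star_ldiv)

lemma displacement_in_B: "a \<in> carrier Q \<Longrightarrow> b \<in> carrier Q \<Longrightarrow> displacement Q a b \<in> carrier B"
  by (simp add: displacement_def L_closed)

lemma displacement_apply:
  assumes "a \<in> carrier Q" "b \<in> carrier Q" "x \<in> carrier Q"
  shows "displacement Q a b x = a \<star> (b \<setminus> x)"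
  using assms
  by (simp add: displacement_def B_mult_apply L_closed inv_L_apply L_apply ldiv_closed)

lemma inv_displacement:
  assumes "a \<in> carrier Q" "b \<in> carrier Q"
  shows "inv\<^bsub>B\<^esub> (displacement Q a b) = displacement Q b a"
  using assms by (simp add: displacement_def B.inv_mult_group L_closed)

lemma carrier_Dis_displacement:
  "carrier D = generate B {displacement Q a b | a b. a \<in> carrier Q \<and> b \<in> carrier Q}"
  unfolding carrier_Dis displacement_def ..

lemma subgroup_Dis: "subgroup (carrier D) B"
  unfolding carrier_Dis_displacement
  by (rule B.generate_is_subgroup) (auto simp: displacement_in_B)

lemma Dis_in_B: "g \<in> carrier D \<Longrightarrow> g \<in> carrier B"
  using subgroup_Dis by (rule subgroup.mem_carrier)

lemma Dis_mult [simp]: "mult D = mult B"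
  by (simp add: Dis_def)

lemma Dis_one [simp]: "\<one>\<^bsub>D\<^esub> = \<one>\<^bsub>B\<^esub>"
  by (simp add: Dis_def)

lemma Dis_inv: "g \<in> carrier D \<Longrightarrow> inv\<^bsub>D\<^esub> g = inv\<^bsub>B\<^esub> g"
  unfolding Dis_def by (rule B.inv_subgroup_generated)

lemma Dis_apply_closed: "g \<in> carrier D \<Longrightarrow> x \<in> carrier Q \<Longrightarrow> g x \<in> carrier Q"
  by (simp add: B_apply_closed Dis_in_B)

lemma Dis_mult_apply:
  "g \<in> carrier D \<Longrightarrow> h \<in> carrier D \<Longrightarrow> x \<in> carrier Q \<Longrightarrow> (g \<otimes>\<^bsub>D\<^esub> h) x = g (h x)"
  by (simp add: B_mult_apply Dis_in_B)

lemma Dis_inv_apply: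
  assumes "g \<in> carrier D" "x \<in> carrier Q"
  shows "(inv\<^bsub>D\<^esub> g) (g x) = x" "g ((inv\<^bsub>D\<^esub> g) x) = x"
  using assms by (simp_all add: Dis_inv B_inv_apply Dis_in_B)

lemma displacement_in_Dis: "a \<in> carrier Q \<Longrightarrow> b \<in> carrier Q \<Longrightarrow> displacement Q a b \<in> carrier D"
  unfolding carrier_Dis_displacement by (auto intro: generate.incl)

lemma Dis_induct [consumes 1, case_names one displacement mult]:
  assumes "g \<in> carrier D"
    and "P \<one>\<^bsub>D\<^esub>"
    and "\<And>a b. a \<in> carrier Q \<Longrightarrow> b \<in> carrier Q \<Longrightarrow> P (displacement Q a b)"
    and "\<And>g h. g \<in> carrier D \<Longrightarrow> h \<in> carrier D \<Longrightarrow> P g \<Longrightarrow> P h \<Longrightarrow> P (g \<otimes>\<^bsub>D\<^esub> h)"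
  shows "P g"
  using assms(1) unfolding carrier_Dis_displacement
proof induction
  case one
  show ?case using assms(2) by simp
next
  case (incl h)
  then show ?case using assms(3) by blast
next
  case (inv h)
  then show ?case using assms(3) by (auto simp: inv_displacement)
next
  case (eng h1 h2)
  then show ?case using assms(4) by (simp add: carrier_Dis_displacement)
qed

lemma Dis_generated: "carrier D = generate D {displacement Q a b | a b. a \<in> carrier Q \<and> b \<in> carrier Q}"
proof -
  let ?S = "{displacement Q a b | a b. a \<in> carrier Q \<and> b \<in> carrier Q}"
  have S: "?S \<subseteq> carrier D" using displacement_in_Dis by auto
  have "g \<in> generate D ?S" if "g \<in> carrier D" for g
    using that by (induction rule: Dis_induct) (auto intro: generate.intros simp del: Dis_mult Dis_one)
  then show ?thesis using D.generate_in_carrier[OF S] by blast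
qed

text \<open>Elements of the displacement group act as unary polynomials.\<close>

lemma Dis_preserves_congruence:
  assumes \<delta>: "congruence Q \<delta>" and g: "g \<in> carrier D" and xy: "(x, y) \<in> \<delta>"
  shows "(g x, g y) \<in> \<delta>"
  using g xy
proof (induction arbitrary: x y rule: Dis_induct)
  case one
  then show ?case using congruence_in_carrier[OF \<delta>] by (simp add: B_one_apply)
next
  case (displacement a b)
  then show ?case
    using congruence_in_carrier[OF \<delta> displacement(3)] congruence_refl[OF \<delta>]
    by (auto simp: displacement_apply intro!: congruence_star[OF \<delta>] congruence_ldiv[OF \<delta>])
next
  case (mult g h)
  have "x \<in> carrier Q" "y \<in> carrier Q" using congruence_in_carrier[OF \<delta> mult(5)] .
  then show ?case using mult by (simp add: Dis_mult_apply del: Dis_mult)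
qed

lemma normal_kernel_of_cong:
  assumes \<delta>: "congruence Q \<delta>"
  shows "kernel_of_cong Q \<delta> \<lhd> D"
proof -
  let ?K = "kernel_of_cong Q \<delta>"
  have in_Dis: "g \<in> carrier D" and near: "\<And>x. x \<in> carrier Q \<Longrightarrow> (g x, x) \<in> \<delta>" if "g \<in> ?K" for g
    using that by (auto simp: kernel_of_cong_def)
  have "subgroup ?K D"
  proof (rule D.subgroupI)
    show "?K \<subseteq> carrier D" using in_Dis by blast
    have "\<one>\<^bsub>D\<^esub> \<in> ?K"
      using D.one_closed congruence_refl[OF \<delta>] by (simp add: kernel_of_cong_def B_one_apply)
    then show "?K \<noteq> {}" by blast
    show "inv\<^bsub>D\<^esub> g \<in> ?K" if g: "g \<in> ?K" for g
    proof -
      have "((inv\<^bsub>D\<^esub> g) x, x) \<in> \<delta>" if x: "x \<in> carrier Q" for x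
        using near[OF g, of "(inv\<^bsub>D\<^esub> g) x"] x in_Dis[OF g] congruence_sym[OF \<delta>]
        by (simp add: Dis_inv_apply Dis_apply_closed)
      then show ?thesis using in_Dis[OF g] by (simp add: kernel_of_cong_def)
    qed
    show "g \<otimes>\<^bsub>D\<^esub> h \<in> ?K" if g: "g \<in> ?K" and h: "h \<in> ?K" for g h
    proof -
      have "((g \<otimes>\<^bsub>D\<^esub> h) x, x) \<in> \<delta>" if x: "x \<in> carrier Q" for x
        using congruence_trans[OF \<delta> near[OF g, of "h x"] near[OF h x]] x in_Dis[OF g] in_Dis[OF h]
        by (simp add: Dis_mult_apply Dis_apply_closed del: Dis_mult)
      then show ?thesis
        using D.m_closed[OF in_Dis[OF g] in_Dis[OF h]] by (simp add: kernel_of_cong_def)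
    qed
  qed
  moreover have "h \<otimes>\<^bsub>D\<^esub> g \<otimes>\<^bsub>D\<^esub> inv\<^bsub>D\<^esub> h \<in> ?K" if h: "h \<in> carrier D" and g: "g \<in> ?K" for h g
  proof -
    have "((h \<otimes>\<^bsub>D\<^esub> g \<otimes>\<^bsub>D\<^esub> inv\<^bsub>D\<^esub> h) x, x) \<in> \<delta>" if x: "x \<in> carrier Q" for x
    proof -
      let ?y = "(inv\<^bsub>D\<^esub> h) x"
      have "?y \<in> carrier Q" using x h by (simp add: Dis_apply_closed)
      then have "(h (g ?y), h ?y) \<in> \<delta>"
        using near[OF g] Dis_preserves_congruence[OF \<delta> h] by blast
      then show ?thesis
        using x h in_Dis[OF g]
        by (simp add: Dis_mult_apply Dis_apply_closed Dis_inv_apply D.m_closed del: Dis_mult)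
    qed
    then show ?thesis
      using D.m_closed[OF D.m_closed[OF h in_Dis[OF g]] D.inv_closed[OF h]]
      by (simp add: kernel_of_cong_def)
  qed
  ultimately show ?thesis by (simp add: D.normal_inv_iff)
qed

lemma kernel_zero_cong: "kernel_of_cong Q (zero_cong Q) = {\<one>\<^bsub>D\<^esub>}"
proof -
  have "g = \<one>\<^bsub>D\<^esub>" if "g \<in> kernel_of_cong Q (zero_cong Q)" for g
    using that by (auto simp: kernel_of_cong_def Id_on_iff B_one_apply Dis_in_B intro!: B_eqI)
  moreover have "\<one>\<^bsub>D\<^esub> \<in> kernel_of_cong Q (zero_cong Q)"
    using D.one_closed by (auto simp: kernel_of_cong_def B_one_apply)
  ultimately show ?thesis by blast
qed

lemma kernel_one_cong: "kernel_of_cong Q (one_cong Q) = carrier D"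
  by (auto simp: kernel_of_cong_def Dis_apply_closed)

text \<open>The proof applies the term condition to the term \<open>L\<^sub>y L\<^sub>d\<^sup>-\<^sup>1 L\<^sub>x L\<^sub>b\<^sup>-\<^sup>1 L\<^sub>d L\<^sub>y\<^sup>-\<^sup>1 w\<close> with parameters \<open>d, b, w\<close>.
  For \<open>x = b\<close> its value is \<open>w\<close> whatever \<open>y\<close> is; for \<open>x = a\<close> its values at \<open>y = d\<close> and
  \<open>y = c\<close> arise from \<open>w\<close> by applying \<open>L\<^sub>a L\<^sub>b\<^sup>-\<^sup>1\<close> and its conjugate by \<open>L\<^sub>c L\<^sub>d\<^sup>-\<^sup>1\<close>.
  These values are therefore congruent modulo \<open>\<delta>\<close>, for every \<open>w\<close>.\<close>

lemma centralizes_commutator_in_kernel: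
  assumes C: "centralizes Q \<alpha> \<beta> \<delta>"
    and \<alpha>: "congruence Q \<alpha>" and \<beta>: "congruence Q \<beta>" and \<delta>: "congruence Q \<delta>"
    and ab: "(a, b) \<in> \<alpha>" and cd: "(c, d) \<in> \<beta>"
  shows "commutator D (displacement Q a b) (displacement Q c d) \<in> kernel_of_cong Q \<delta>"
proof -
  note carrier = congruence_in_carrier[OF \<alpha> ab] congruence_in_carrier[OF \<beta> cd]
  let ?u = "displacement Q a b" and ?v = "displacement Q c d"
  define t where "t = Star (Var 1) (Ldiv (Var 2) (Star (Var 0) (Ldiv (Var 3)
    (Star (Var 2) (Ldiv (Var 1) (Var 4))))))"
  have t_op: "term_op Q t [x, y, d', b', w]
      = y \<star> (d' \<setminus> (x \<star> (b' \<setminus> (d' \<star> (y \<setminus> w)))))" for x y d' b' w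
    by (simp add: t_def numeral_nat)
  have move: "(?u w, ?v (?u (d \<star> (c \<setminus> w)))) \<in> \<delta>" if w: "w \<in> carrier Q" for w
  proof -
    have "\<forall>i<4. ([d, d, b, w] ! i, [c, d, b, w] ! i) \<in> \<beta>"
      using cd carrier w congruence_refl[OF \<beta>] congruence_sym[OF \<beta>]
      by (auto simp: less_Suc_eq numeral_nat)
    moreover have "vars t \<subseteq> {..4}" by (auto simp: t_def)
    moreover have "(term_op Q t (b # [d, d, b, w]), term_op Q t (b # [c, d, b, w])) \<in> \<delta>"
      using carrier w congruence_refl[OF \<delta>]
      by (simp add: t_op star_closed ldiv_closed star_ldiv ldiv_star)
    ultimately have "(term_op Q t (a # [d, d, b, w]), term_op Q t (a # [c, d, b, w])) \<in> \<delta>"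
      using C[unfolded centralizes_def, rule_format, of t 4 b a "[d, d, b, w]" "[c, d, b, w]"]
        congruence_sym[OF \<alpha> ab] by simp
    then show ?thesis
      using carrier w
      by (simp add: t_op displacement_apply star_closed ldiv_closed star_ldiv ldiv_star)
  qed
  have uv: "?u \<in> carrier D" "?v \<in> carrier D"
    using carrier by (simp_all add: displacement_in_Dis)
  have "(commutator D ?u ?v x, x) \<in> \<delta>" if x: "x \<in> carrier Q" for x
  proof -
    define w where "w = (inv\<^bsub>D\<^esub> ?u) ((inv\<^bsub>D\<^esub> ?v) x)"
    have w: "w \<in> carrier Q" using uv x by (simp add: w_def Dis_apply_closed)
    have vw: "?v w \<in> carrier Q" using uv w by (simp add: Dis_apply_closed)
    have "d \<star> (c \<setminus> ?v w) = w"
      using w carrier by (simp add: displacement_apply star_closed ldiv_closed star_ldiv ldiv_star)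
    then have "(?u (?v w), ?v (?u w)) \<in> \<delta>"
      using move[OF vw] by simp
    moreover have "?v (?u w) = x"
      using uv x by (simp add: w_def Dis_inv_apply Dis_apply_closed)
    moreover have "commutator D ?u ?v x = ?u (?v w)"
      using uv x
      by (simp add: commutator_def w_def Dis_mult_apply Dis_apply_closed D.m_closed del: Dis_mult)
    ultimately show ?thesis by simp
  qed
  then show ?thesis
    using uv by (simp add: kernel_of_cong_def)
qed

end

section \<open>Orbit congruences of a rack\<close>

definition translation_invariant :: "('a, 'c) left_quasigroup_scheme \<Rightarrow> ('a \<Rightarrow> 'a) set \<Rightarrow> bool"
  where "translation_invariant Q M \<longleftrightarrow> (\<forall>a\<in>carrier Q. translation_conj Q a ` M = M)"

context rack
begin

lemma ldiv_distrib:
  assumes "a \<in> carrier Q" "x \<in> carrier Q" "y \<in> carrier Q"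
  shows "a \<setminus> (x \<star> y) = (a \<setminus> x) \<star> (a \<setminus> y)"
proof -
  have "a \<star> ((a \<setminus> x) \<star> (a \<setminus> y)) = x \<star> y"
    using assms self_distrib[of a "a \<setminus> x" "a \<setminus> y"] by (simp add: ldiv_closed star_ldiv)
  then show ?thesis
    using assms ldiv_star[of a "(a \<setminus> x) \<star> (a \<setminus> y)"] by (simp add: star_closed ldiv_closed)
qed

lemma Dis_star:
  assumes "g \<in> carrier D" "x \<in> carrier Q" "y \<in> carrier Q"
  shows "g (x \<star> y) = g x \<star> g y"
  using assms
proof (induction arbitrary: x y rule: Dis_induct)
  case one
  then show ?case by (simp add: B_one_apply star_closed)
next
  case (displacement a b)
  then show ?case
    by (simp add: displacement_apply star_closed ldiv_closed ldiv_distrib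
        self_distrib[symmetric])
next
  case (mult g h)
  then show ?case by (simp add: Dis_mult_apply Dis_apply_closed star_closed del: Dis_mult)
qed

lemma Dis_ldiv:
  assumes "g \<in> carrier D" "x \<in> carrier Q" "y \<in> carrier Q"
  shows "g (x \<setminus> y) = g x \<setminus> g y"
  using Dis_star[OF assms(1,2) ldiv_closed[OF assms(2,3)]] assms
  by (simp add: star_ldiv) (metis Dis_apply_closed ldiv_closed ldiv_star)

lemma translation_conj_apply:
  assumes "a \<in> carrier Q" "g \<in> carrier D" "x \<in> carrier Q"
  shows "translation_conj Q a g x = a \<star> g (a \<setminus> x)"
  using assms
  by (simp add: translation_conj_def B_mult_apply L_closed Dis_in_B inv_L_apply L_apply
      ldiv_closed B_apply_closed)

lemma translation_conj_displacement:
  assumes "a \<in> carrier Q" "b \<in> carrier Q" "c \<in> carrier Q"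
  shows "translation_conj Q a (displacement Q b c) = displacement Q (a \<star> b) (a \<star> c)"
proof (rule B_eqI)
  show "translation_conj Q a (displacement Q b c) \<in> carrier B"
    using assms by (simp add: translation_conj_def L_closed displacement_in_B)
  fix x assume x: "x \<in> carrier Q"
  have "(a \<star> c) \<star> (a \<star> (c \<setminus> (a \<setminus> x))) = x"
    using assms x by (simp add: self_distrib[symmetric] ldiv_closed star_ldiv)
  then have "(a \<star> c) \<setminus> x = a \<star> (c \<setminus> (a \<setminus> x))"
    using assms x ldiv_star[of "a \<star> c" "a \<star> (c \<setminus> (a \<setminus> x))"]
    by (simp add: star_closed ldiv_closed)
  then show "translation_conj Q a (displacement Q b c) x = displacement Q (a \<star> b) (a \<star> c) x"
    using assms x
    by (simp add: translation_conj_apply displacement_in_Dis displacement_apply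
        self_distrib[symmetric] star_closed ldiv_closed)
qed (use assms in \<open>simp add: displacement_in_B star_closed\<close>)

lemma translation_conj_mult:
  assumes "a \<in> carrier Q" "g \<in> carrier B" "h \<in> carrier B"
  shows "translation_conj Q a (g \<otimes>\<^bsub>B\<^esub> h) = translation_conj Q a g \<otimes>\<^bsub>B\<^esub> translation_conj Q a h"
  using assms L_closed[OF assms(1)] by (simp add: translation_conj_def B.m_assoc)

text \<open>Left translations need not lie in \<open>Dis Q\<close>, but conjugation by \<open>L\<^sub>a\<close> permutes its
  generators: it applies the automorphism \<open>L\<^sub>a\<close> of \<open>Q\<close> to their indices.\<close>

lemma translation_conj_iso:
  assumes a: "a \<in> carrier Q"
  shows "translation_conj Q a \<in> iso D D"
proof -
  have conj_one: "translation_conj Q a \<one>\<^bsub>B\<^esub> = \<one>\<^bsub>B\<^esub>"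
    using L_closed[OF a] by (simp add: translation_conj_def)
  have closed: "translation_conj Q a g \<in> carrier D" if "g \<in> carrier D" for g
    using that
  proof (induction rule: Dis_induct)
    case one
    show ?case using D.one_closed by (simp add: conj_one)
  next
    case (displacement b c)
    then show ?case
      using a by (simp add: translation_conj_displacement displacement_in_Dis star_closed)
  next
    case (mult g h)
    then show ?case
      using D.m_closed a by (simp add: translation_conj_mult Dis_in_B)
  qed
  have surj: "g \<in> translation_conj Q a ` carrier D" if "g \<in> carrier D" for g
    using that
  proof (induction rule: Dis_induct)
    case one
    show ?case using D.one_closed by (auto simp: conj_one intro!: image_eqI[of _ _ "\<one>\<^bsub>B\<^esub>"])
  next
    case (displacement b c)
    then show ?case
      using a by (intro image_eqI[of _ _ "displacement Q (a \<setminus> b) (a \<setminus> c)"])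
        (simp_all add: translation_conj_displacement displacement_in_Dis ldiv_closed star_ldiv)
  next
    case (mult g h)
    then obtain g' h' where g': "g' \<in> carrier D" "g = translation_conj Q a g'"
      and h': "h' \<in> carrier D" "h = translation_conj Q a h'" by auto
    then have "g \<otimes>\<^bsub>D\<^esub> h = translation_conj Q a (g' \<otimes>\<^bsub>D\<^esub> h')"
      using a by (simp add: translation_conj_mult Dis_in_B)
    then show ?case using D.m_closed[OF g'(1) h'(1)] by blast
  qed
  have "inj_on (translation_conj Q a) (carrier D)"
  proof (rule inj_onI)
    fix g h assume "g \<in> carrier D" "h \<in> carrier D" "translation_conj Q a g = translation_conj Q a h"
    then show "g = h"
      using L_closed[OF a] by (simp add: translation_conj_def Dis_in_B B.m_assoc)
  qed
  then show ?thesis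
    using closed surj a
    by (auto simp: iso_def hom_def bij_betw_def translation_conj_mult Dis_in_B)
qed

lemma translation_conj_closed:
  "translation_invariant Q M \<Longrightarrow> a \<in> carrier Q \<Longrightarrow> g \<in> M \<Longrightarrow> translation_conj Q a g \<in> M"
  by (auto simp: translation_invariant_def)

lemma translation_conj_preimage:
  assumes "translation_invariant Q M" "a \<in> carrier Q" "g \<in> M"
  obtains g' where "g' \<in> M" "g = translation_conj Q a g'"
  using assms by (auto simp: translation_invariant_def)

text \<open>As \<open>g\<close> is an automorphism, \<open>g x \<star> h y = g (x \<star> k y)\<close> with \<open>k = g\<^sup>-\<^sup>1 h\<close>, and
  \<open>x \<star> k y\<close> arises from \<open>x \<star> y\<close> by applying the conjugate of \<open>k\<close> by \<open>L\<^sub>x\<close>, again an element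
  of \<open>M\<close>. For \<open>\<setminus>\<close> the conjugate by the inverse of \<open>L\<^sub>x\<close> takes its place.\<close>

lemma congruence_orbit_rel:
  assumes M: "subgroup M D" and inv: "translation_invariant Q M"
  shows "congruence Q (orbit_rel Q M)"
proof -
  interpret M: subgroup M D by (rule M)
  have in_D: "g \<in> carrier D" if "g \<in> M" for g using that by (rule M.mem_carrier)
  have orbitI: "(x, g x) \<in> orbit_rel Q M" if "x \<in> carrier Q" "g \<in> M" for x g
    using that by (auto simp: orbit_rel_def)
  have "equiv (carrier Q) (orbit_rel Q M)"
  proof (rule equivI)
    show "orbit_rel Q M \<subseteq> carrier Q \<times> carrier Q"
      by (auto simp: orbit_rel_def in_D Dis_apply_closed)
    show "refl_on (carrier Q) (orbit_rel Q M)"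
      using orbitI[OF _ M.one_closed] by (auto simp: refl_on_def B_one_apply)
    show "sym (orbit_rel Q M)"
    proof (rule symI)
      fix x y assume "(x, y) \<in> orbit_rel Q M"
      then obtain g where g: "x \<in> carrier Q" "g \<in> M" "y = g x" by (auto simp: orbit_rel_def)
      then show "(y, x) \<in> orbit_rel Q M"
        using orbitI[of "g x" "inv\<^bsub>D\<^esub> g"] by (simp add: in_D Dis_apply_closed Dis_inv_apply)
    qed
    show "trans (orbit_rel Q M)"
    proof (rule transI)
      fix x y z assume "(x, y) \<in> orbit_rel Q M" "(y, z) \<in> orbit_rel Q M"
      then obtain g h where g: "x \<in> carrier Q" "g \<in> M" "h \<in> M" "z = h (g x)"
        by (auto simp: orbit_rel_def)
      then show "(x, z) \<in> orbit_rel Q M"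
        using orbitI[OF g(1) M.m_closed[OF g(3,2)]] by (simp add: in_D Dis_mult_apply del: Dis_mult)
    qed
  qed
  moreover have "(x \<star> y, x' \<star> y') \<in> orbit_rel Q M \<and> (x \<setminus> y, x' \<setminus> y') \<in> orbit_rel Q M"
    if xx: "(x, x') \<in> orbit_rel Q M" and yy: "(y, y') \<in> orbit_rel Q M" for x x' y y'
  proof -
    from xx obtain g where g: "x \<in> carrier Q" "g \<in> M" "x' = g x" by (auto simp: orbit_rel_def)
    from yy obtain h where h: "y \<in> carrier Q" "h \<in> M" "y' = h y" by (auto simp: orbit_rel_def)
    define k where "k = inv\<^bsub>D\<^esub> g \<otimes>\<^bsub>D\<^esub> h"
    have k: "k \<in> M" using g(2) h(2) by (simp add: k_def del: Dis_mult)
    have hy: "h y = g (k y)"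
      using g h by (simp add: k_def in_D Dis_mult_apply Dis_inv_apply Dis_apply_closed del: Dis_mult)
    have ky: "k y \<in> carrier Q" using k h by (simp add: in_D Dis_apply_closed)
    let ?s = "translation_conj Q x k"
    obtain l where l: "l \<in> M" "k = translation_conj Q x l"
      using translation_conj_preimage[OF inv g(1) k] .
    have s: "?s \<in> M" using inv g(1) k by (rule translation_conj_closed)
    have "x' \<star> y' = (g \<otimes>\<^bsub>D\<^esub> ?s) (x \<star> y)"
      using g h k s ky
      by (simp add: hy in_D Dis_mult_apply translation_conj_apply Dis_star[symmetric]
          star_closed ldiv_star del: Dis_mult)
    then have "(x \<star> y, x' \<star> y') \<in> orbit_rel Q M"
      using orbitI[OF _ M.m_closed[OF g(2) s]] g h star_closed by simp
    moreover have "x \<setminus> k y = l (x \<setminus> y)"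
      using g h l by (simp add: in_D translation_conj_apply ldiv_closed ldiv_star Dis_apply_closed)
    then have "x' \<setminus> y' = (g \<otimes>\<^bsub>D\<^esub> l) (x \<setminus> y)"
      using g h ky l(1)
      by (simp add: hy in_D Dis_mult_apply Dis_ldiv[symmetric] ldiv_closed del: Dis_mult)
    then have "(x \<setminus> y, x' \<setminus> y') \<in> orbit_rel Q M"
      using orbitI[OF _ M.m_closed[OF g(2) l(1)]] g h ldiv_closed by simp
    ultimately show ?thesis by blast
  qed
  ultimately show ?thesis by (simp add: congruence_def)
qed

text \<open>For \<open>q = m p\<close> the automorphism \<open>m\<close> gives \<open>L\<^sub>q = m L\<^sub>p m\<^sup>-\<^sup>1\<close>, hence
  \<open>L\<^sub>p L\<^sub>q\<^sup>-\<^sup>1 = (L\<^sub>p m L\<^sub>p\<^sup>-\<^sup>1) m\<^sup>-\<^sup>1\<close>, a product of two elements of \<open>M\<close>.\<close>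

lemma displacement_in_orbit_group:
  assumes M: "subgroup M D" and inv: "translation_invariant Q M" and pq: "(p, q) \<in> orbit_rel Q M"
  shows "displacement Q p q \<in> M"
proof -
  interpret M: subgroup M D by (rule M)
  from pq obtain m where p: "p \<in> carrier Q" and m: "m \<in> M" "q = m p" by (auto simp: orbit_rel_def)
  have mD: "m \<in> carrier D" using m(1) by (rule M.mem_carrier)
  have c: "translation_conj Q p m \<in> M" using inv p m(1) by (rule translation_conj_closed)
  have q: "q \<in> carrier Q" using p mD m(2) by (simp add: Dis_apply_closed)
  have "displacement Q p q = translation_conj Q p m \<otimes>\<^bsub>D\<^esub> inv\<^bsub>D\<^esub> m"
  proof (rule B_eqI)
    show "translation_conj Q p m \<otimes>\<^bsub>D\<^esub> inv\<^bsub>D\<^esub> m \<in> carrier B"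
      using M.m_closed[OF c M.m_inv_closed[OF m(1)]] M.mem_carrier Dis_in_B by blast
    fix x assume x: "x \<in> carrier Q"
    have "m (p \<setminus> (inv\<^bsub>D\<^esub> m) x) = q \<setminus> x"
      using p mD x by (simp add: m(2) Dis_ldiv Dis_apply_closed Dis_inv_apply)
    then show "displacement Q p q x = (translation_conj Q p m \<otimes>\<^bsub>D\<^esub> inv\<^bsub>D\<^esub> m) x"
      using p q mD x M.mem_carrier[OF c]
      by (simp add: displacement_apply Dis_mult_apply translation_conj_apply Dis_apply_closed
          del: Dis_mult)
  qed (use p q in \<open>simp add: displacement_in_B\<close>)
  then show ?thesis
    using M.m_closed[OF c M.m_inv_closed[OF m(1)]] by simp
qed

text \<open>The core of the way from groups to congruences. The hypothesis says that on \<open>M\<close>, up to \<open>\<delta>\<close>,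
  conjugation by \<open>L\<^sub>p\<close> depends only on the \<open>\<beta>\<close>-class of \<open>p\<close>. The claim \<open>shift\<close> in the proof
  provides, for fixed \<open>t\<close>, \<open>a\<close>, \<open>m\<close>, one \<open>d \<in> M\<close> that takes \<open>t(a, v)\<close> to \<open>t(m a, v)\<close> up to
  \<open>\<delta>\<close>, for all \<open>v\<close> in the \<open>\<beta>\<close>-class of \<open>u\<close> at once. As \<open>d\<close> preserves \<open>\<delta>\<close>, the term
  condition follows.\<close>

lemma centralizes_orbit_rel_if_translations_agree:
  assumes M: "subgroup M D" and inv: "translation_invariant Q M"
    and \<beta>: "congruence Q \<beta>" and \<delta>: "congruence Q \<delta>"
    and agree: "\<And>p q g x. (p, q) \<in> \<beta> \<Longrightarrow> g \<in> M \<Longrightarrow> x \<in> carrier Q \<Longrightarrow>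
      (p \<star> g (p \<setminus> x), q \<star> g (q \<setminus> x)) \<in> \<delta>"
  shows "centralizes Q (orbit_rel Q M) \<beta> \<delta>"
proof -
  interpret M: subgroup M D by (rule M)
  have in_D: "g \<in> carrier D" if "g \<in> M" for g using that by (rule M.mem_carrier)
  \<comment> \<open>The hypothesis for \<open>L\<^sub>p\<^sup>-\<^sup>1\<close> follows from the one for \<open>L\<^sub>p\<close>, applied to \<open>L\<^sub>p\<^sup>-\<^sup>1 g L\<^sub>p\<close>.\<close>
  have agree_ldiv: "(p \<setminus> g (p \<star> x), q \<setminus> g (q \<star> x)) \<in> \<delta>"
    if pq: "(p, q) \<in> \<beta>" and g: "g \<in> M" and x: "x \<in> carrier Q" for p q g x
  proof -
    note carrier = congruence_in_carrier[OF \<beta> pq]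
    obtain h where h: "h \<in> M" "g = translation_conj Q p h"
      using translation_conj_preimage[OF inv carrier(1) g] .
    have hx: "h x \<in> carrier Q" using h x by (simp add: in_D Dis_apply_closed)
    have "(g (q \<star> x), q \<star> h x) \<in> \<delta>"
      using agree[OF pq h(1), of "q \<star> x"] carrier x h
      by (simp add: in_D translation_conj_apply star_closed ldiv_star)
    then have "(q \<setminus> g (q \<star> x), q \<setminus> (q \<star> h x)) \<in> \<delta>"
      using congruence_ldiv[OF \<delta>] congruence_refl[OF \<delta>] carrier by blast
    moreover have "p \<setminus> g (p \<star> x) = h x"
      using carrier x h hx by (simp add: in_D translation_conj_apply star_closed ldiv_star)
    ultimately show ?thesis
      using carrier hx congruence_sym[OF \<delta>] by (simp add: ldiv_star)
  qed
  have shift: "\<exists>d\<in>M. \<forall>vs. length vs = length us \<longrightarrow> (\<forall>i<length us. (us ! i, vs ! i) \<in> \<beta>) \<longrightarrow>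
      (term_op Q t (m a # vs), d (term_op Q t (a # vs))) \<in> \<delta>"
    if t: "vars t \<subseteq> {..length us}" and a: "a \<in> carrier Q" and m: "m \<in> M"
      and us: "set us \<subseteq> carrier Q" for t us a m
  proof -
    let ?near = "\<lambda>vs. length vs = length us \<and> (\<forall>i<length us. (us ! i, vs ! i) \<in> \<beta>)"
    have near_term: "(term_op Q s (a # us), term_op Q s (a # vs)) \<in> \<beta>"
      if "?near vs" "vars s \<subseteq> {..length us}" for s vs
      using that a congruence_refl[OF \<beta>]
      by (intro term_op_congruent[OF \<beta>]) (auto simp: list_all2_conv_all_nth lessThan_Suc_atMost nth_Cons split: nat.split)
    have "\<exists>d\<in>M. \<forall>vs. ?near vs \<longrightarrow> (term_op Q t (m a # vs), d (term_op Q t (a # vs))) \<in> \<delta>"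
      using t
    proof (induction t)
      case (Var i)
      show ?case
      proof (cases i)
        case 0
        have "(m a, m a) \<in> \<delta>"
          using a m congruence_refl[OF \<delta>] by (simp add: in_D Dis_apply_closed)
        then show ?thesis using m 0 by auto
      next
        case (Suc j)
        have "(vs ! j, \<one>\<^bsub>D\<^esub> (vs ! j)) \<in> \<delta>" if "?near vs" for vs
        proof -
          have "j < length us" using Var Suc by auto
          then have "vs ! j \<in> carrier Q" using that congruence_in_carrier[OF \<beta>] by blast
          then show ?thesis using congruence_refl[OF \<delta>] by (simp add: B_one_apply)
        qed
        then show ?thesis using Suc M.one_closed by auto
      qed
    next
      case (Star s r)
      then obtain d e where d: "d \<in> M"
          "\<And>vs. ?near vs \<Longrightarrow> (term_op Q s (m a # vs), d (term_op Q s (a # vs))) \<in> \<delta>"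
        and e: "e \<in> M"
          "\<And>vs. ?near vs \<Longrightarrow> (term_op Q r (m a # vs), e (term_op Q r (a # vs))) \<in> \<delta>"
        by auto
      \<comment> \<open>With values \<open>S\<close>, \<open>R\<close> of the subterms: \<open>d S \<star> e R = d (S \<star> g R)\<close> for \<open>g = d\<^sup>-\<^sup>1 e\<close>, and
        \<open>S \<star> g R\<close> is the conjugate of \<open>g\<close> by \<open>L\<^sub>S\<close> applied to \<open>S \<star> R\<close>. Up to \<open>\<delta>\<close>, the index
        \<open>S\<close> may be replaced by its value \<open>p\<close> at the reference tuple \<open>us\<close>.\<close>
      define g where "g = inv\<^bsub>D\<^esub> d \<otimes>\<^bsub>D\<^esub> e"
      have g: "g \<in> M" using d(1) e(1) by (simp add: g_def del: Dis_mult)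
      define p where "p = term_op Q s (a # us)"
      have p: "p \<in> carrier Q"
        unfolding p_def using Star.prems a us
        by (intro term_op_closed) (auto simp: lessThan_Suc_atMost)
      let ?c = "translation_conj Q p g"
      have c: "?c \<in> M" using inv p g by (rule translation_conj_closed)
      have "(term_op Q (Star s r) (m a # vs), (d \<otimes>\<^bsub>D\<^esub> ?c) (term_op Q (Star s r) (a # vs))) \<in> \<delta>"
        if vs: "?near vs" for vs
      proof -
        let ?S = "term_op Q s (a # vs)" and ?R = "term_op Q r (a # vs)"
        have pS: "(p, ?S) \<in> \<beta>"
          unfolding p_def using near_term[OF vs] Star.prems by simp
        have "(term_op Q r (a # us), ?R) \<in> \<beta>"
          using near_term[OF vs] Star.prems by simp
        then have SR: "?S \<in> carrier Q" "?R \<in> carrier Q"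
          using congruence_in_carrier[OF \<beta>] pS by blast+
        have eR: "e ?R = d (g ?R)"
          using SR d(1) e(1)
          by (simp add: g_def in_D Dis_mult_apply Dis_inv_apply Dis_apply_closed del: Dis_mult)
        have "d ?S \<star> e ?R = d (?S \<star> g (?S \<setminus> (?S \<star> ?R)))"
          using SR d(1) g by (simp add: eR in_D Dis_star Dis_apply_closed ldiv_star)
        moreover have "(d (?S \<star> g (?S \<setminus> (?S \<star> ?R))), d (?c (?S \<star> ?R))) \<in> \<delta>"
          using agree[OF congruence_sym[OF \<beta> pS] g star_closed[OF SR]] SR d(1) g p
          by (simp add: in_D Dis_preserves_congruence[OF \<delta>] translation_conj_apply star_closed)
        ultimately have "(term_op Q (Star s r) (m a # vs), d (?c (?S \<star> ?R))) \<in> \<delta>"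
          using congruence_trans[OF \<delta> congruence_star[OF \<delta> d(2)[OF vs] e(2)[OF vs]]] by simp
        then show ?thesis
          using SR d(1) c by (simp add: in_D Dis_mult_apply star_closed del: Dis_mult)
      qed
      then show ?case using M.m_closed[OF d(1) c] by blast
    next
      case (Ldiv s r)
      then obtain d e where d: "d \<in> M"
          "\<And>vs. ?near vs \<Longrightarrow> (term_op Q s (m a # vs), d (term_op Q s (a # vs))) \<in> \<delta>"
        and e: "e \<in> M"
          "\<And>vs. ?near vs \<Longrightarrow> (term_op Q r (m a # vs), e (term_op Q r (a # vs))) \<in> \<delta>"
        by auto
      define g where "g = inv\<^bsub>D\<^esub> d \<otimes>\<^bsub>D\<^esub> e"
      have g: "g \<in> M" using d(1) e(1) by (simp add: g_def del: Dis_mult)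
      define p where "p = term_op Q s (a # us)"
      have p: "p \<in> carrier Q"
        unfolding p_def using Ldiv.prems a us
        by (intro term_op_closed) (auto simp: lessThan_Suc_atMost)
      obtain c where c: "c \<in> M" "g = translation_conj Q p c"
        using translation_conj_preimage[OF inv p g] .
      have "(term_op Q (Ldiv s r) (m a # vs), (d \<otimes>\<^bsub>D\<^esub> c) (term_op Q (Ldiv s r) (a # vs))) \<in> \<delta>"
        if vs: "?near vs" for vs
      proof -
        let ?S = "term_op Q s (a # vs)" and ?R = "term_op Q r (a # vs)"
        have pS: "(p, ?S) \<in> \<beta>"
          unfolding p_def using near_term[OF vs] Ldiv.prems by simp
        have "(term_op Q r (a # us), ?R) \<in> \<beta>"
          using near_term[OF vs] Ldiv.prems by simp
        then have SR: "?S \<in> carrier Q" "?R \<in> carrier Q"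
          using congruence_in_carrier[OF \<beta>] pS by blast+
        have SR': "?S \<setminus> ?R \<in> carrier Q" using SR by (rule ldiv_closed)
        have eR: "e ?R = d (g ?R)"
          using SR d(1) e(1)
          by (simp add: g_def in_D Dis_mult_apply Dis_inv_apply Dis_apply_closed del: Dis_mult)
        have "d ?S \<setminus> e ?R = d (?S \<setminus> g (?S \<star> (?S \<setminus> ?R)))"
          using SR d(1) g by (simp add: eR in_D Dis_ldiv Dis_apply_closed star_ldiv)
        moreover have "p \<setminus> g (p \<star> (?S \<setminus> ?R)) = c (?S \<setminus> ?R)"
          using SR' p c by (simp add: in_D translation_conj_apply star_closed ldiv_star Dis_apply_closed)
        moreover have "(d (?S \<setminus> g (?S \<star> (?S \<setminus> ?R))), d (p \<setminus> g (p \<star> (?S \<setminus> ?R)))) \<in> \<delta>"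
          using agree_ldiv[OF congruence_sym[OF \<beta> pS] g SR'] d(1)
          by (simp add: in_D Dis_preserves_congruence[OF \<delta>])
        ultimately have "(term_op Q (Ldiv s r) (m a # vs), d (c (?S \<setminus> ?R))) \<in> \<delta>"
          using congruence_trans[OF \<delta> congruence_ldiv[OF \<delta> d(2)[OF vs] e(2)[OF vs]]] by simp
        then show ?thesis
          using SR' d(1) c(1) by (simp add: in_D Dis_mult_apply del: Dis_mult)
      qed
      then show ?case using M.m_closed[OF d(1) c(1)] by blast
    qed
    then show ?thesis by blast
  qed
  show ?thesis
    unfolding centralizes_def
  proof (intro allI impI)
    fix n t a b us vs
    assume A: "vars t \<subseteq> {..n}" "(a, b) \<in> orbit_rel Q M" "length us = n" "length vs = n"
      "\<forall>i<n. (us ! i, vs ! i) \<in> \<beta>" "(term_op Q t (a # us), term_op Q t (a # vs)) \<in> \<delta>"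
    from A(2) obtain m where a: "a \<in> carrier Q" and m: "m \<in> M" "b = m a"
      by (auto simp: orbit_rel_def)
    have us_Q: "us ! i \<in> carrier Q" if "i < n" for i
      using that A(5) congruence_in_carrier[OF \<beta>] by blast
    then have us: "set us \<subseteq> carrier Q"
      using A(3) by (metis in_set_conv_nth subsetI)
    obtain d where d: "d \<in> M" and near: "\<And>ws. length ws = length us \<Longrightarrow>
        (\<forall>i<length us. (us ! i, ws ! i) \<in> \<beta>) \<Longrightarrow>
        (term_op Q t (m a # ws), d (term_op Q t (a # ws))) \<in> \<delta>"
      using shift[OF _ a m(1) us, of t] A(1,3) by blast
    have "(d (term_op Q t (a # us)), d (term_op Q t (a # vs))) \<in> \<delta>"
      using Dis_preserves_congruence[OF \<delta> in_D[OF d] A(6)] .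
    moreover have "(term_op Q t (b # us), d (term_op Q t (a # us))) \<in> \<delta>"
      using near[of us] us_Q A(3) congruence_refl[OF \<beta>] m(2) by simp
    moreover have "(term_op Q t (b # vs), d (term_op Q t (a # vs))) \<in> \<delta>"
      using near[of vs] A(3-5) m(2) by simp
    ultimately show "(term_op Q t (b # us), term_op Q t (b # vs)) \<in> \<delta>"
      using congruence_trans[OF \<delta>] congruence_sym[OF \<delta>] by blast
  qed
qed

text \<open>With \<open>u = L\<^sub>p L\<^sub>q\<^sup>-\<^sup>1\<close> and \<open>h = L\<^sub>q g L\<^sub>q\<^sup>-\<^sup>1\<close>, the conjugate \<open>L\<^sub>p g L\<^sub>p\<^sup>-\<^sup>1\<close> is
  \<open>u h u\<^sup>-\<^sup>1 = [u, h] h\<close>, so the two conjugates of \<open>g\<close> differ by an element of \<open>N\<close>.\<close>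

lemma centralizes_orbit_rel:
  assumes M: "subgroup M D" "translation_invariant Q M"
    and N: "subgroup N D" "translation_invariant Q N"
    and \<beta>: "congruence Q \<beta>"
    and comm: "\<And>p q g. (p, q) \<in> \<beta> \<Longrightarrow> g \<in> M \<Longrightarrow> commutator D (displacement Q p q) g \<in> N"
  shows "centralizes Q (orbit_rel Q M) \<beta> (orbit_rel Q N)"
proof (rule centralizes_orbit_rel_if_translations_agree[OF M \<beta> congruence_orbit_rel[OF N]])
  fix p q g x
  assume pq: "(p, q) \<in> \<beta>" and g: "g \<in> M" and x: "x \<in> carrier Q"
  note carrier = congruence_in_carrier[OF \<beta> pq]
  let ?u = "displacement Q p q" and ?g = "translation_conj Q q g"
  have g': "?g \<in> M" using M(2) carrier(2) g by (rule translation_conj_closed)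
  have in_D: "?u \<in> carrier D" "?g \<in> carrier D" "g \<in> carrier D"
    using carrier g g' subgroup.mem_carrier[OF M(1)] by (auto simp: displacement_in_Dis)
  have inv_u: "inv\<^bsub>D\<^esub> ?u = displacement Q q p"
    using in_D(1) carrier by (simp add: Dis_inv inv_displacement)
  have "(inv\<^bsub>D\<^esub> ?g) (q \<star> g (q \<setminus> x)) = x"
    using Dis_inv_apply(1)[OF in_D(2) x] in_D(3) carrier x by (simp add: translation_conj_apply)
  then have "commutator D ?u ?g (?g x) = p \<star> g (p \<setminus> x)"
    using in_D carrier x
    by (simp add: commutator_def Dis_mult_apply Dis_inv_apply Dis_apply_closed D.m_closed inv_u
        displacement_apply translation_conj_apply star_closed ldiv_closed ldiv_star displacement_in_Dis
        del: Dis_mult)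
  moreover have "(?g x, commutator D ?u ?g (?g x)) \<in> orbit_rel Q N"
    using comm[OF pq g'] in_D x by (auto simp: orbit_rel_def Dis_apply_closed)
  moreover have "?g x = q \<star> g (q \<setminus> x)"
    using in_D carrier x by (simp add: translation_conj_apply)
  ultimately show "(p \<star> g (p \<setminus> x), q \<star> g (q \<setminus> x)) \<in> orbit_rel Q N"
    using congruence_sym[OF congruence_orbit_rel[OF N]] by simp
qed

end

section \<open>Solvability and nilpotence\<close>

context rack
begin

lemma Dis_conj_displacement:
  assumes g: "g \<in> carrier D" and a: "a \<in> carrier Q" and b: "b \<in> carrier Q"
  shows "g \<otimes>\<^bsub>D\<^esub> displacement Q a b \<otimes>\<^bsub>D\<^esub> inv\<^bsub>D\<^esub> g = displacement Q (g a) (g b)"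
proof (rule B_eqI)
  have d: "displacement Q a b \<in> carrier D" using a b by (rule displacement_in_Dis)
  show "g \<otimes>\<^bsub>D\<^esub> displacement Q a b \<otimes>\<^bsub>D\<^esub> inv\<^bsub>D\<^esub> g \<in> carrier B"
    using D.m_closed[OF D.m_closed[OF g d] D.inv_closed[OF g]] by (rule Dis_in_B)
  fix x assume x: "x \<in> carrier Q"
  then show "(g \<otimes>\<^bsub>D\<^esub> displacement Q a b \<otimes>\<^bsub>D\<^esub> inv\<^bsub>D\<^esub> g) x = displacement Q (g a) (g b) x"
    using g a b d
    by (simp add: Dis_mult_apply D.m_closed Dis_apply_closed displacement_apply Dis_star Dis_ldiv
        Dis_inv_apply ldiv_closed del: Dis_mult)
qed (use g a b in \<open>simp add: displacement_in_B Dis_apply_closed\<close>)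

text \<open>The first factor and the conjugated one are displacements between congruent elements as
  soon as \<open>g\<close> fixes the classes of a congruence.\<close>

lemma commutator_displacement:
  assumes g: "g \<in> carrier D" and a: "a \<in> carrier Q" and b: "b \<in> carrier Q"
  shows "commutator D g (displacement Q a b) = displacement Q (g a) a \<otimes>\<^bsub>D\<^esub>
    (displacement Q a b \<otimes>\<^bsub>D\<^esub> displacement Q b (g b) \<otimes>\<^bsub>D\<^esub> inv\<^bsub>D\<^esub> (displacement Q a b))"
proof -
  have gab: "g a \<in> carrier Q" "g b \<in> carrier Q" using g a b by (simp_all add: Dis_apply_closed)
  have inv: "inv\<^bsub>D\<^esub> (displacement Q a b) = displacement Q b a"
    using a b by (simp add: Dis_inv displacement_in_Dis inv_displacement)
  have "commutator D g (displacement Q a b) = displacement Q (g a) (g b) \<otimes>\<^bsub>D\<^esub> displacement Q b a"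
    using Dis_conj_displacement[OF assms] by (simp add: commutator_def inv del: Dis_mult)
  also have "\<dots> = displacement Q (g a) a \<otimes>\<^bsub>D\<^esub>
      (displacement Q a b \<otimes>\<^bsub>D\<^esub> displacement Q b (g b) \<otimes>\<^bsub>D\<^esub> displacement Q b a)"
    using a b gab
    by (intro B_eqI)
      (simp_all add: B_mult_apply displacement_in_B B_apply_closed displacement_apply
        star_closed ldiv_closed ldiv_star)
  finally show ?thesis by (simp only: inv)
qed

lemma commutator_kernel_of_cong:
  assumes \<alpha>: "congruence Q \<alpha>" and P: "P \<lhd> D"
    and disp: "\<And>a b. (a, b) \<in> \<alpha> \<Longrightarrow> displacement Q a b \<in> P"
    and g: "g \<in> kernel_of_cong Q \<alpha>" and h: "h \<in> carrier D"
  shows "commutator D g h \<in> P"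
proof -
  interpret P: subgroup P D using P by (rule normal_imp_subgroup)
  have gD: "g \<in> carrier D" and near: "\<And>x. x \<in> carrier Q \<Longrightarrow> (g x, x) \<in> \<alpha>"
    using g by (auto simp: kernel_of_cong_def)
  show ?thesis
  proof (rule D.commutator_generate_in_normal[OF P gD])
    show "{displacement Q a b | a b. a \<in> carrier Q \<and> b \<in> carrier Q} \<subseteq> carrier D"
      using displacement_in_Dis by auto
    show "h \<in> generate D {displacement Q a b | a b. a \<in> carrier Q \<and> b \<in> carrier Q}"
      using h Dis_generated by simp
    fix s assume "s \<in> {displacement Q a b | a b. a \<in> carrier Q \<and> b \<in> carrier Q}"
    then obtain a b where s: "s = displacement Q a b" and ab: "a \<in> carrier Q" "b \<in> carrier Q"
      by blast
    have "displacement Q (g a) a \<in> P" "displacement Q b (g b) \<in> P"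
      using disp near ab congruence_sym[OF \<alpha>] by blast+
    then show "commutator D g s \<in> P"
      unfolding s commutator_displacement[OF gD ab]
      using P.m_closed[OF _ D.normal_conj(1)[OF P _ displacement_in_Dis[OF ab]]] by blast
  qed
qed

text \<open>The first derived subgroup lies in the normal subgroup generated by the displacements
  between \<open>\<alpha>\<close>-congruent elements, and these generators commute modulo the kernel of \<open>\<delta>\<close>.\<close>

lemma derived_derived_kernel_subset:
  assumes \<alpha>: "congruence Q \<alpha>" and \<delta>: "congruence Q \<delta>" and C: "centralizes Q \<alpha> \<alpha> \<delta>"
  shows "derived D (derived D (kernel_of_cong Q \<alpha>)) \<subseteq> kernel_of_cong Q \<delta>"
proof -
  let ?S = "{displacement Q a b | a b. (a, b) \<in> \<alpha>}"
  have S: "?S \<subseteq> carrier D"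
    using displacement_in_Dis congruence_in_carrier[OF \<alpha>] by blast
  have normal: "generate D ?S \<lhd> D"
  proof (rule D.normal_generateI[OF S])
    fix s g assume "s \<in> ?S" and g: "g \<in> carrier D"
    then obtain a b where ab: "s = displacement Q a b" "(a, b) \<in> \<alpha>" by blast
    then have "g \<otimes>\<^bsub>D\<^esub> s \<otimes>\<^bsub>D\<^esub> inv\<^bsub>D\<^esub> g = displacement Q (g a) (g b)"
      using Dis_conj_displacement[OF g] congruence_in_carrier[OF \<alpha>] by blast
    then show "g \<otimes>\<^bsub>D\<^esub> s \<otimes>\<^bsub>D\<^esub> inv\<^bsub>D\<^esub> g \<in> ?S"
      using Dis_preserves_congruence[OF \<alpha> g ab(2)] by blast
  qed
  have "derived_set D (kernel_of_cong Q \<alpha>) \<subseteq> generate D ?S"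
  proof -
    have "commutator D g h \<in> generate D ?S"
      if "g \<in> kernel_of_cong Q \<alpha>" "h \<in> kernel_of_cong Q \<alpha>" for g h
      using that(2) by (intro commutator_kernel_of_cong[OF \<alpha> normal _ that(1)])
        (auto simp: kernel_of_cong_def intro: generate.incl)
    then show ?thesis by (auto simp: commutator_def)
  qed
  then have "derived D (kernel_of_cong Q \<alpha>) \<subseteq> generate D ?S"
    unfolding derived_def using normal_imp_subgroup[OF normal] by (rule D.generate_subgroup_incl)
  then have "derived D (derived D (kernel_of_cong Q \<alpha>)) \<subseteq> derived D (generate D ?S)"
    by (rule D.mono_derived)
  also have "\<dots> \<subseteq> kernel_of_cong Q \<delta>"
    using centralizes_commutator_in_kernel[OF C \<alpha> \<alpha> \<delta>]
    by (intro D.derived_generate_subset_normal[OF normal_kernel_of_cong[OF \<delta>] S]) blast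
  finally show ?thesis .
qed

lemma solvable_Dis_if_lq_solvable:
  assumes "lq_solvable Q"
  shows "solvable D"
proof -
  from assms obtain n \<alpha> where chain: "congruence_chain Q n \<alpha>"
    and C: "\<And>i. i < n \<Longrightarrow> centralizes Q (\<alpha> (Suc i)) (\<alpha> (Suc i)) (\<alpha> i)"
    unfolding lq_solvable_iff by blast
  let ?K = "\<lambda>i. kernel_of_cong Q (\<alpha> i)"
  have "((derived D) ^^ (2 * j)) (carrier D) \<subseteq> ?K (n - j)" if "j \<le> n" for j
    using that
  proof (induction j)
    case 0
    then show ?case using chain by (simp add: congruence_chain_def kernel_one_cong)
  next
    case (Suc j)
    define i where "i = n - Suc j"
    have i: "n - j = Suc i" "i < n" using Suc.prems by (auto simp: i_def)
    have cong: "congruence Q (\<alpha> (Suc i))" "congruence Q (\<alpha> i)"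
      using chain i by (auto simp: congruence_chain_def)
    have "(derived D ^^ (2 * Suc j)) (carrier D) = (derived D ^^ 2) ((derived D ^^ (2 * j)) (carrier D))"
      by (simp add: numeral_2_eq_2)
    also have "\<dots> \<subseteq> (derived D ^^ 2) (?K (Suc i))"
      using Suc i by (intro D.mono_exp_of_derived) simp
    also have "\<dots> \<subseteq> ?K i"
      using derived_derived_kernel_subset[OF cong C[OF i(2)]] by (simp add: numeral_2_eq_2)
    finally show ?case by (simp add: i_def)
  qed
  from this[of n] have "((derived D) ^^ (2 * n)) (carrier D) \<subseteq> {\<one>\<^bsub>D\<^esub>}"
    using chain by (simp add: congruence_chain_def kernel_zero_cong)
  moreover have "\<one>\<^bsub>D\<^esub> \<in> ((derived D) ^^ (2 * n)) (carrier D)"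
    using D.exp_of_derived_is_subgroup[OF D.subgroup_self] by (rule subgroup.one_closed)
  ultimately show ?thesis
    unfolding D.solvable_iff_trivial_derived_seq by blast
qed

text \<open>Each congruence in the chain takes two steps in the upper central series: the displacements
  between congruent elements are central modulo the previous kernel, and the commutators of the
  next kernel with \<open>Dis Q\<close> are products of conjugates of such displacements.\<close>

lemma nilpotent_Dis_if_lq_nilpotent:
  assumes "lq_nilpotent Q"
  shows "nilpotent_group D"
proof -
  from assms obtain n \<alpha> where chain: "congruence_chain Q n \<alpha>"
    and C: "\<And>i. i < n \<Longrightarrow> centralizes Q (\<alpha> (Suc i)) (one_cong Q) (\<alpha> i)"
    unfolding lq_nilpotent_iff by blast
  let ?K = "\<lambda>i. kernel_of_cong Q (\<alpha> i)"
  have "?K i \<subseteq> upper_central D (2 * i)" if "i \<le> n" for i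
    using that
  proof (induction i)
    case 0
    then show ?case using chain by (simp add: congruence_chain_def kernel_zero_cong)
  next
    case (Suc i)
    have cong: "congruence Q (\<alpha> (Suc i))" "congruence Q (\<alpha> i)"
      using chain Suc.prems by (auto simp: congruence_chain_def)
    have central: "displacement Q a b \<in> upper_central D (Suc (2 * i))" if ab: "(a, b) \<in> \<alpha> (Suc i)" for a b
    proof -
      have u: "displacement Q a b \<in> carrier D"
        using congruence_in_carrier[OF cong(1) ab] by (rule displacement_in_Dis)
      have "commutator D (displacement Q a b) h \<in> ?K i" if h: "h \<in> carrier D" for h
      proof (rule D.commutator_generate_in_normal[OF normal_kernel_of_cong[OF cong(2)] u])
        show "{displacement Q c d | c d. c \<in> carrier Q \<and> d \<in> carrier Q} \<subseteq> carrier D"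
          using displacement_in_Dis by auto
        show "h \<in> generate D {displacement Q c d | c d. c \<in> carrier Q \<and> d \<in> carrier Q}"
          using h Dis_generated by simp
        show "commutator D (displacement Q a b) s \<in> ?K i"
          if "s \<in> {displacement Q c d | c d. c \<in> carrier Q \<and> d \<in> carrier Q}" for s
          using that centralizes_commutator_in_kernel[OF C cong(1) congruence_one_cong cong(2) ab]
            Suc.prems by auto
      qed
      then show ?thesis using u Suc by auto
    qed
    have "commutator D g h \<in> upper_central D (Suc (2 * i))"
      if "g \<in> ?K (Suc i)" "h \<in> carrier D" for g h
      using commutator_kernel_of_cong[OF cong(1) D.normal_upper_central central that] .
    then show ?case by (auto simp: kernel_of_cong_def)
  qed
  from this[of n] have "carrier D \<subseteq> upper_central D (2 * n)"
    using chain by (simp add: congruence_chain_def kernel_one_cong)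
  then have "upper_central D (2 * n) = carrier D"
    using subgroup.subset[OF normal_imp_subgroup[OF D.normal_upper_central]] by blast
  then show ?thesis unfolding D.nilpotent_group_iff_upper_central ..
qed

lemma translation_invariant_derived: "translation_invariant Q ((derived D ^^ n) (carrier D))"
  using D.derived_series_iso_image[OF translation_conj_iso] by (simp add: translation_invariant_def)

lemma translation_invariant_upper_central: "translation_invariant Q (upper_central D n)"
  using D.upper_central_iso_image[OF translation_conj_iso] by (simp add: translation_invariant_def)

text \<open>If all left translations agree modulo \<open>\<delta>\<close>, then the class of a term depends on its
  rightmost variable only. If this is the distinguished variable of the term condition, the
  conclusion compares two terms with the same value of it; otherwise exchanging \<open>a\<close> for \<open>b\<close>
  does not change the class.\<close>

lemma centralizes_one_cong_if_translations_agree: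
  assumes \<delta>: "congruence Q \<delta>"
    and same: "\<And>x x' y. x \<in> carrier Q \<Longrightarrow> x' \<in> carrier Q \<Longrightarrow> y \<in> carrier Q \<Longrightarrow> (x \<star> y, x' \<star> y) \<in> \<delta>"
  shows "centralizes Q (one_cong Q) (one_cong Q) \<delta>"
proof -
  have star: "(x \<star> y, x' \<star> y') \<in> \<delta>" if "x \<in> carrier Q" "x' \<in> carrier Q" "(y, y') \<in> \<delta>" for x x' y y'
    using that same[of x x' y] congruence_star[OF \<delta> congruence_refl[OF \<delta>]]
      congruence_in_carrier[OF \<delta>] congruence_trans[OF \<delta>] by blast
  have same_ldiv: "(x \<setminus> y, x' \<setminus> y) \<in> \<delta>"
    if "x \<in> carrier Q" "x' \<in> carrier Q" "y \<in> carrier Q" for x x' y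
  proof -
    have "(y, x' \<star> (x \<setminus> y)) \<in> \<delta>"
      using same[of x x' "x \<setminus> y"] that by (simp add: ldiv_closed star_ldiv)
    then have "(x' \<setminus> y, x' \<setminus> (x' \<star> (x \<setminus> y))) \<in> \<delta>"
      using congruence_ldiv[OF \<delta> congruence_refl[OF \<delta>]] that by blast
    then show ?thesis
      using that congruence_sym[OF \<delta>] by (simp add: ldiv_closed ldiv_star)
  qed
  have ldiv: "(x \<setminus> y, x' \<setminus> y') \<in> \<delta>" if "x \<in> carrier Q" "x' \<in> carrier Q" "(y, y') \<in> \<delta>" for x x' y y'
    using that same_ldiv[of x x' y] congruence_ldiv[OF \<delta> congruence_refl[OF \<delta>]]
      congruence_in_carrier[OF \<delta>] congruence_trans[OF \<delta>] by blast
  let ?T = "\<lambda>n. {xs. length xs = Suc n \<and> set xs \<subseteq> carrier Q}"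
  have rightmost: "\<exists>i\<le>n. \<forall>xs\<in>?T n. \<forall>ys\<in>?T n. (xs ! i, ys ! i) \<in> \<delta> \<longrightarrow>
      (term_op Q t xs, term_op Q t ys) \<in> \<delta>" if "vars t \<subseteq> {..n}" for n t
    using that
  proof (induction t)
    case (Var i)
    then show ?case by auto
  next
    case (Star s r)
    have "term_op Q s xs \<in> carrier Q" if "xs \<in> ?T n" for xs
      using that Star.prems by (intro term_op_closed) (auto simp: lessThan_Suc_atMost)
    moreover obtain i where "i \<le> n" "\<forall>xs\<in>?T n. \<forall>ys\<in>?T n. (xs ! i, ys ! i) \<in> \<delta> \<longrightarrow>
        (term_op Q r xs, term_op Q r ys) \<in> \<delta>"
      using Star by auto
    ultimately show ?case by (intro exI[of _ i]) (simp add: star)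
  next
    case (Ldiv s r)
    have "term_op Q s xs \<in> carrier Q" if "xs \<in> ?T n" for xs
      using that Ldiv.prems by (intro term_op_closed) (auto simp: lessThan_Suc_atMost)
    moreover obtain i where "i \<le> n" "\<forall>xs\<in>?T n. \<forall>ys\<in>?T n. (xs ! i, ys ! i) \<in> \<delta> \<longrightarrow>
        (term_op Q r xs, term_op Q r ys) \<in> \<delta>"
      using Ldiv by auto
    ultimately show ?case by (intro exI[of _ i]) (simp add: ldiv)
  qed
  show ?thesis
    unfolding centralizes_def
  proof (intro allI impI)
    fix n t a b us vs
    assume A: "vars t \<subseteq> {..n}" "(a, b) \<in> one_cong Q" "length us = n" "length vs = n"
      "\<forall>i<n. (us ! i, vs ! i) \<in> one_cong Q" "(term_op Q t (a # us), term_op Q t (a # vs)) \<in> \<delta>"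
    have "set us \<subseteq> carrier Q" "set vs \<subseteq> carrier Q"
      using A(3-5) by (auto simp: in_set_conv_nth)
    then have T: "a # us \<in> ?T n" "a # vs \<in> ?T n" "b # us \<in> ?T n" "b # vs \<in> ?T n"
      using A(2-4) by auto
    obtain i where i: "i \<le> n" and dep: "\<And>xs ys. xs \<in> ?T n \<Longrightarrow> ys \<in> ?T n \<Longrightarrow>
        (xs ! i, ys ! i) \<in> \<delta> \<Longrightarrow> (term_op Q t xs, term_op Q t ys) \<in> \<delta>"
      using rightmost[OF A(1)] by blast
    show "(term_op Q t (b # us), term_op Q t (b # vs)) \<in> \<delta>"
    proof (cases i)
      case 0
      then show ?thesis
        using A(2) congruence_refl[OF \<delta>] by (intro dep T) auto
    next
      case (Suc j)
      have "us ! j \<in> carrier Q" "vs ! j \<in> carrier Q"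
        using A(5) i Suc by auto
      then have "(us ! j, us ! j) \<in> \<delta>" "(vs ! j, vs ! j) \<in> \<delta>"
        by (simp_all add: congruence_refl[OF \<delta>])
      then have "(term_op Q t (b # us), term_op Q t (a # us)) \<in> \<delta>"
        "(term_op Q t (a # vs), term_op Q t (b # vs)) \<in> \<delta>"
        using Suc T by (auto intro!: dep)
      then show ?thesis
        using A(6) congruence_trans[OF \<delta>] by blast
    qed
  qed
qed

text \<open>\<open>Dis Q\<close> need not act transitively, hence the additional step from its orbits to the full
  relation.\<close>

lemma congruence_chain_orbit_rel:
  assumes M: "\<And>i. i \<le> n \<Longrightarrow> subgroup (M i) D" "\<And>i. i \<le> n \<Longrightarrow> translation_invariant Q (M i)"
    and mono: "\<And>i. i < n \<Longrightarrow> M i \<subseteq> M (Suc i)"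
    and M0: "M 0 = {\<one>\<^bsub>D\<^esub>}"
  shows "congruence_chain Q (Suc n) (\<lambda>i. if i \<le> n then orbit_rel Q (M i) else one_cong Q)"
proof -
  have "orbit_rel Q {\<one>\<^bsub>D\<^esub>} = zero_cong Q"
    by (auto simp: orbit_rel_def Id_on_def B_one_apply)
  moreover have "orbit_rel Q (M i) \<subseteq> orbit_rel Q (M (Suc i))" if "i < n" for i
    using mono[OF that] by (auto simp: orbit_rel_def)
  moreover have "orbit_rel Q (M i) \<subseteq> one_cong Q" if "i \<le> n" for i
    using congruence_in_carrier[OF congruence_orbit_rel[OF M[OF that]]] by auto
  ultimately show ?thesis
    using congruence_orbit_rel[OF M] congruence_one_cong M0
    unfolding congruence_chain_def by (auto simp: less_Suc_eq)
qed

lemma centralizes_one_cong_orbit_rel_Dis: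
  "centralizes Q (one_cong Q) (one_cong Q) (orbit_rel Q (carrier D))"
proof (rule centralizes_one_cong_if_translations_agree)
  have "translation_invariant Q (carrier D)"
    using translation_invariant_derived[of 0] by simp
  then show "congruence Q (orbit_rel Q (carrier D))"
    using D.subgroup_self by (rule congruence_orbit_rel[rotated])
  fix x x' y assume xy: "x \<in> carrier Q" "x' \<in> carrier Q" "y \<in> carrier Q"
  have "x' \<star> y = displacement Q x' x (x \<star> y)"
    using xy by (simp add: displacement_apply star_closed ldiv_star)
  then show "(x \<star> y, x' \<star> y) \<in> orbit_rel Q (carrier D)"
    using xy displacement_in_Dis[OF xy(2,1)] star_closed by (auto simp: orbit_rel_def)
qed

lemma lq_solvable_if_solvable_Dis:
  assumes "solvable D"
  shows "lq_solvable Q"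
proof -
  obtain n where n: "(derived D ^^ n) (carrier D) = {\<one>\<^bsub>D\<^esub>}"
    using assms unfolding D.solvable_iff_trivial_derived_seq by blast
  define M where "M i = (derived D ^^ (n - i)) (carrier D)" for i
  let ?\<alpha> = "\<lambda>i. if i \<le> n then orbit_rel Q (M i) else one_cong Q"
  have sub: "subgroup (M i) D" for i
    unfolding M_def by (rule D.exp_of_derived_is_subgroup[OF D.subgroup_self])
  have inv: "translation_invariant Q (M i)" for i
    unfolding M_def by (rule translation_invariant_derived)
  have step: "M i = derived D (M (Suc i))" if "i < n" for i
    using that unfolding M_def by (simp flip: Suc_diff_Suc)
  have "M i \<subseteq> M (Suc i)" if "i < n" for i
    unfolding step[OF that] by (rule D.derived_incl[OF order_refl sub])
  then have "congruence_chain Q (Suc n) ?\<alpha>"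
    using n by (intro congruence_chain_orbit_rel sub inv) (auto simp: M_def)
  moreover have "centralizes Q (?\<alpha> (Suc i)) (?\<alpha> (Suc i)) (?\<alpha> i)" if "i < Suc n" for i
  proof (cases "i = n")
    case True
    then show ?thesis
      using centralizes_one_cong_orbit_rel_Dis by (simp add: M_def)
  next
    case False
    then have i: "i < n" using that by simp
    have "centralizes Q (orbit_rel Q (M (Suc i))) (orbit_rel Q (M (Suc i))) (orbit_rel Q (M i))"
    proof (rule centralizes_orbit_rel[OF sub inv sub inv congruence_orbit_rel[OF sub inv]])
      fix p q g assume pq: "(p, q) \<in> orbit_rel Q (M (Suc i))" and g: "g \<in> M (Suc i)"
      have "displacement Q p q \<in> M (Suc i)"
        using sub inv pq by (rule displacement_in_orbit_group)
      then show "commutator D (displacement Q p q) g \<in> M i"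
        unfolding step[OF i] derived_def commutator_def using g by (intro generate.incl) blast
    qed
    then show ?thesis using i by simp
  qed
  ultimately show ?thesis
    unfolding lq_solvable_iff by blast
qed

lemma lq_nilpotent_if_nilpotent_Dis:
  assumes "nilpotent_group D"
  shows "lq_nilpotent Q"
proof -
  obtain n where n: "upper_central D n = carrier D"
    using assms unfolding D.nilpotent_group_iff_upper_central by blast
  let ?\<alpha> = "\<lambda>i. if i \<le> n then orbit_rel Q (upper_central D i) else one_cong Q"
  have sub: "subgroup (upper_central D i) D" for i
    by (rule normal_imp_subgroup[OF D.normal_upper_central])
  note inv = translation_invariant_upper_central
  have "congruence_chain Q (Suc n) ?\<alpha>"
    by (intro congruence_chain_orbit_rel sub inv D.upper_central_mono upper_central.simps(1))
  moreover have "centralizes Q (?\<alpha> (Suc i)) (one_cong Q) (?\<alpha> i)" if "i < Suc n" for i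
  proof (cases "i = n")
    case True
    then show ?thesis
      using centralizes_one_cong_orbit_rel_Dis by (simp add: n)
  next
    case False
    then have i: "i < n" using that by simp
    have "centralizes Q (orbit_rel Q (upper_central D (Suc i))) (one_cong Q)
        (orbit_rel Q (upper_central D i))"
    proof (rule centralizes_orbit_rel[OF sub inv sub inv congruence_one_cong])
      fix p q g assume pq: "(p, q) \<in> one_cong Q" and g: "g \<in> upper_central D (Suc i)"
      then have u: "displacement Q p q \<in> carrier D" by (simp add: displacement_in_Dis)
      then have "commutator D g (displacement Q p q) \<in> upper_central D i"
        using g by simp
      then show "commutator D (displacement Q p q) g \<in> upper_central D i"
        using D.commutator_swap_in_normal[OF D.normal_upper_central _ u] g by simp
    qed
    then show ?thesis using i by simp
  qed
  ultimately show ?thesis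
    unfolding lq_nilpotent_iff by blast
qed

end

theorem theorem1p2:
  fixes Q :: "('a, 'c) left_quasigroup_scheme"
  assumes "rack Q"
  shows "(lq_solvable Q \<longleftrightarrow> solvable (Dis Q)) \<and>
         (lq_nilpotent Q \<longleftrightarrow> nilpotent_group (Dis Q))"
proof -
  interpret rack Q by (rule assms)
  show ?thesis
    using solvable_Dis_if_lq_solvable lq_solvable_if_solvable_Dis
      nilpotent_Dis_if_lq_nilpotent lq_nilpotent_if_nilpotent_Dis by blast
qed

end
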